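(* Let $W$ be a Weyl tensor with self-dual Weyl tensor $\mathcal W$ and Bel-Robinson tensor $T$, and suppose $T^3=0$ and $T^2\neq 0$. Let $u$ be an arbitrary time-like vector, $X=u\otimes u$, and define $$\Lambda=\frac{T^2(X)}{\sqrt{T^2(X,X)}},\qquad 2R_{\alpha\beta\mu\nu\rho\sigma}=(T\cdot T)_{\alpha\beta\rho\sigma\mu\nu}+(T\cdot T)_{\alpha\beta\sigma\rho\mu\nu}-T_{\alpha\beta\mu\nu}\Lambda_{\rho\sigma}-\tfrac12 (T^2)_{\alpha\beta\mu\nu}g_{\rho\sigma},$$ $$\Pi=\frac{1}{T^2(X,X)}\left[R(X,X)-\frac{R(X,X,X)}{2\,T^2(X,X)}\,T^2(X)\right].$$ Put $h=\frac12 g-\Pi$, $v=\frac12 g+\Pi$, $$l=-\frac{\Lambda(u)}{\sqrt{\Lambda(u,u)}},\quad p=\frac{h(w)}{\sqrt{h(w,w)}},\quad L=l\wedge p,\quad \mathcal L_0=\tfrac1{\sqrt2}(L-\mathrm i*L),$$ $$e=-\frac{v(u)}{v(l,u)},\quad U=l\wedge e,\quad \mathcal U=\tfrac1{\sqrt2}(U-\mathrm i*U),$$ where $w$ is an arbitrary vector such that $h(w)\neq0$. Then $W$ is obtained from $T$ up to a duality rotation: there is a real $\theta$ such that $$\mathcal W=e^{\mathrm i\theta}\,\mathcal W_0,\qquad \mathcal W_0=\mathcal U\otimes\mathcal L_0+\mathcal L_0\otimes\mathcal U .$$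
   Context: $(V,g)$ is an oriented 4-dimensional real vector space with a Lorentzian metric of signature $(-,+,+,+)$ (the tangent space of a space-time at a point); indices are moved with $g$; $\eta$ is the metric volume element. Hodge dual: $( *F)_{\alpha\beta}=\frac12\eta_{\alpha\beta\mu\nu}F^{\mu\nu}$ for 2-forms, $( *W)_{\alpha\beta\mu\nu}=\frac12\eta_{\alpha\beta}{}^{\rho\sigma}W_{\rho\sigma\mu\nu}$ for double 2-forms. A Weyl tensor $W$ is a real 4-tensor with the algebraic symmetries of a Riemann tensor and vanishing traces; its self-dual Weyl tensor is $\mathcal W=\frac12(W-\mathrm i*W)$. The Bel-Robinson (BR) tensor of $W$ is $T_{\alpha\mu\beta\nu}=\mathcal W_{\alpha}{}^{\rho}{}_{\beta}{}^{\sigma}\,\overline{\mathcal W}_{\mu\rho\nu\sigma}$; it is real, totally symmetric and traceless. Powers are as endomorphisms of symmetric tensors: $(T^2)_{\alpha\beta\rho\sigma}=T_{\alpha\beta}{}^{\mu\nu}T_{\mu\nu\rho\sigma}$, $T^3=T^2$ composed with $T$ in the same way. $(T\cdot T)_{\alpha\beta\rho\sigma\mu\nu}=T_{\alpha\beta\rho\epsilon}T^{\epsilon}{}_{\sigma\mu\nu}$. For a 4-tensor $S$: $S(X)_{\alpha\beta}=S_{\alpha\beta\mu\nu}X^{\mu\nu}$, $S(X,X)=S_{\alpha\beta\mu\nu}X^{\alpha\beta}X^{\mu\nu}$. For the 6-tensor $R$: $R(X,X)_{\alpha\beta}=R_{\alpha\beta\mu\nu\rho\sigma}X^{\mu\nu}X^{\rho\sigma}$,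 $R(X,X,X)=R(X,X)_{\alpha\beta}X^{\alpha\beta}$. For a 2-tensor $A$: $A(y)^\alpha=A^\alpha{}_\beta y^\beta$, $A(y,z)=A_{\alpha\beta}y^\alpha z^\beta$. For vectors $(l\wedge p)_{\alpha\beta}=l_\alpha p_\beta-p_\alpha l_\beta$. *)

theory Defs
  imports "HOL-Analysis.Analysis"
begin

text \<open>
  The space is \<^typ>\<open>real^4\<close> with an arbitrary Lorentzian metric \<open>g\<close>, i.e. everything is written in
  components with respect to an arbitrary, not necessarily orthonormal, basis. Apart from vectors
  and the argument \<open>X\<close> of \<open>S(X)\<close> and \<open>R(X,X)\<close>, all arrays hold covariant components; indices
  are raised explicitly with \<^term>\<open>matrix_inv g\<close>. The index type \<^typ>\<open>4\<close> has the elements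
  \<open>0, 1, 2, 3\<close>.
\<close>

type_synonym vect = "real^4"
type_synonym 'a tensor2 = "'a^4^4"
type_synonym 'a tensor4 = "'a^4^4^4^4"
type_synonym 'a tensor6 = "'a^4^4^4^4^4^4"

definition minkowski :: "real tensor2" where
  "minkowski = (\<chi> i j. if i = j then (if i = 0 then -1 else 1) else 0)"

text \<open>Columns of \<open>P\<close> form an orthonormal basis; this makes \<open>g\<close> symmetric and nondegenerate.\<close>

definition lorentzian :: "real tensor2 \<Rightarrow> bool" where
  "lorentzian g \<longleftrightarrow> (\<exists>P :: real^4^4. invertible P \<and> transpose P ** g ** P = minkowski)"

definition bil :: "real tensor2 \<Rightarrow> vect \<Rightarrow> vect \<Rightarrow> real" where
  "bil A y z = (\<Sum>\<alpha>\<in>UNIV. \<Sum>\<beta>\<in>UNIV. A$\<alpha>$\<beta> * y$\<alpha> * z$\<beta>)"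

definition timelike :: "real tensor2 \<Rightarrow> vect \<Rightarrow> bool" where
  "timelike g u \<longleftrightarrow> bil g u u < 0"

text \<open>\<open>A(y)\<close> is a vector: the first index of \<open>A\<close> is raised.\<close>

definition vec_apply :: "real tensor2 \<Rightarrow> real tensor2 \<Rightarrow> vect \<Rightarrow> vect" where
  "vec_apply g A y = matrix_inv g *v (A *v y)"

definition wedge :: "real tensor2 \<Rightarrow> vect \<Rightarrow> vect \<Rightarrow> real tensor2" where
  "wedge g l p = (\<chi> \<alpha> \<beta>. (g *v l)$\<alpha> * (g *v p)$\<beta> - (g *v p)$\<alpha> * (g *v l)$\<beta>)"

definition levi_civita :: "4 \<Rightarrow> 4 \<Rightarrow> 4 \<Rightarrow> 4 \<Rightarrow> real" where
  "levi_civita \<alpha> \<beta> \<mu> \<nu> =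
     det ((\<chi> i. axis (if i = 0 then \<alpha> else if i = 1 then \<beta> else if i = 2 then \<mu> else \<nu>) 1) :: real^4^4)"

text \<open>
  The orientation is a sign \<open>ori\<close>: it is \<open>1\<close> if the standard basis is positively oriented and
  \<open>-1\<close> otherwise.
\<close>

definition volume_element :: "real tensor2 \<Rightarrow> real \<Rightarrow> real tensor4" where
  "volume_element g ori =
     (\<chi> \<alpha> \<beta> \<mu> \<nu>. ori * sqrt \<bar>det g\<bar> * levi_civita \<alpha> \<beta> \<mu> \<nu>)"

definition hodge2 :: "real tensor2 \<Rightarrow> real \<Rightarrow> real tensor2 \<Rightarrow> real tensor2" where
  "hodge2 g ori F = (\<chi> \<alpha> \<beta>. 1/2 * (\<Sum>\<mu>\<in>UNIV. \<Sum>\<nu>\<in>UNIV. \<Sum>\<rho>\<in>UNIV. \<Sum>\<sigma>\<in>UNIV.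
     volume_element g ori $\<alpha>$\<beta>$\<mu>$\<nu> * matrix_inv g $\<mu>$\<rho> * matrix_inv g $\<nu>$\<sigma> * F$\<rho>$\<sigma>))"

definition hodge4 :: "real tensor2 \<Rightarrow> real \<Rightarrow> real tensor4 \<Rightarrow> real tensor4" where
  "hodge4 g ori W = (\<chi> \<alpha> \<beta> \<mu> \<nu>. 1/2 * (\<Sum>\<rho>\<in>UNIV. \<Sum>\<sigma>\<in>UNIV. \<Sum>\<kappa>\<in>UNIV. \<Sum>\<tau>\<in>UNIV.
     volume_element g ori $\<alpha>$\<beta>$\<kappa>$\<tau> * matrix_inv g $\<kappa>$\<rho> * matrix_inv g $\<tau>$\<sigma> * W$\<rho>$\<sigma>$\<mu>$\<nu>))"

definition weyl_tensor :: "real tensor2 \<Rightarrow> real tensor4 \<Rightarrow> bool" where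
  "weyl_tensor g W \<longleftrightarrow>
     (\<forall>\<alpha> \<beta> \<mu> \<nu>. W$\<alpha>$\<beta>$\<mu>$\<nu> = - W$\<beta>$\<alpha>$\<mu>$\<nu>) \<and>
     (\<forall>\<alpha> \<beta> \<mu> \<nu>. W$\<alpha>$\<beta>$\<mu>$\<nu> = - W$\<alpha>$\<beta>$\<nu>$\<mu>) \<and>
     (\<forall>\<alpha> \<beta> \<mu> \<nu>. W$\<alpha>$\<beta>$\<mu>$\<nu> = W$\<mu>$\<nu>$\<alpha>$\<beta>) \<and>
     (\<forall>\<alpha> \<beta> \<mu> \<nu>. W$\<alpha>$\<beta>$\<mu>$\<nu> + W$\<alpha>$\<mu>$\<nu>$\<beta> + W$\<alpha>$\<nu>$\<beta>$\<mu> = 0) \<and>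
     (\<forall>\<beta> \<nu>. (\<Sum>\<alpha>\<in>UNIV. \<Sum>\<mu>\<in>UNIV. matrix_inv g $\<alpha>$\<mu> * W$\<alpha>$\<beta>$\<mu>$\<nu>) = 0)"

definition self_dual_weyl :: "real tensor2 \<Rightarrow> real \<Rightarrow> real tensor4 \<Rightarrow> complex tensor4" where
  "self_dual_weyl g ori W = (\<chi> \<alpha> \<beta> \<mu> \<nu>. 1/2 *
     (complex_of_real (W$\<alpha>$\<beta>$\<mu>$\<nu>) - \<i> * complex_of_real (hodge4 g ori W $\<alpha>$\<beta>$\<mu>$\<nu>)))"

text \<open>Note the normalisation \<open>1/sqrt 2\<close> for 2-forms, as opposed to \<open>1/2\<close> for Weyl tensors.\<close>

definition self_dual_form :: "real tensor2 \<Rightarrow> real \<Rightarrow> real tensor2 \<Rightarrow> complex tensor2" where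
  "self_dual_form g ori F = (\<chi> \<alpha> \<beta>. complex_of_real (1 / sqrt 2) *
     (complex_of_real (F$\<alpha>$\<beta>) - \<i> * complex_of_real (hodge2 g ori F $\<alpha>$\<beta>)))"

text \<open>
  The contraction below is real whenever \<open>W\<close> is a Weyl tensor, so \<^const>\<open>Re\<close> only changes
  the type of the components.
\<close>

definition bel_robinson :: "real tensor2 \<Rightarrow> real \<Rightarrow> real tensor4 \<Rightarrow> real tensor4" where
  "bel_robinson g ori W = (let V = self_dual_weyl g ori W in
     \<chi> \<alpha> \<mu> \<beta> \<nu>. Re (\<Sum>\<rho>\<in>UNIV. \<Sum>\<sigma>\<in>UNIV. \<Sum>\<kappa>\<in>UNIV. \<Sum>\<tau>\<in>UNIV.
       V$\<alpha>$\<kappa>$\<beta>$\<tau> * complex_of_real (matrix_inv g $\<kappa>$\<rho>) * complex_of_real (matrix_inv g $\<tau>$\<sigma>) *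
       cnj (V$\<mu>$\<rho>$\<nu>$\<sigma>)))"

text \<open>\<open>(S \<circ> T)\<close> with \<open>(S \<circ> T)(Y) = S(T(Y))\<close>: the last two indices of \<open>S\<close> are raised and contracted.\<close>

definition tensor_comp :: "real tensor2 \<Rightarrow> real tensor4 \<Rightarrow> real tensor4 \<Rightarrow> real tensor4" where
  "tensor_comp g S T = (\<chi> \<alpha> \<beta> \<rho> \<sigma>. \<Sum>\<mu>\<in>UNIV. \<Sum>\<nu>\<in>UNIV. \<Sum>\<kappa>\<in>UNIV. \<Sum>\<tau>\<in>UNIV.
     S$\<alpha>$\<beta>$\<kappa>$\<tau> * matrix_inv g $\<kappa>$\<mu> * matrix_inv g $\<tau>$\<nu> * T$\<mu>$\<nu>$\<rho>$\<sigma>)"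

definition tensor_dot :: "real tensor2 \<Rightarrow> real tensor4 \<Rightarrow> real tensor4 \<Rightarrow> real tensor6" where
  "tensor_dot g S T = (\<chi> \<alpha> \<beta> \<rho> \<sigma> \<mu> \<nu>. \<Sum>\<epsilon>\<in>UNIV. \<Sum>\<kappa>\<in>UNIV.
     S$\<alpha>$\<beta>$\<rho>$\<epsilon> * matrix_inv g $\<epsilon>$\<kappa> * T$\<kappa>$\<sigma>$\<mu>$\<nu>)"

definition apply4 :: "real tensor4 \<Rightarrow> real tensor2 \<Rightarrow> real tensor2" where
  "apply4 S X = (\<chi> \<alpha> \<beta>. \<Sum>\<mu>\<in>UNIV. \<Sum>\<nu>\<in>UNIV. S$\<alpha>$\<beta>$\<mu>$\<nu> * X$\<mu>$\<nu>)"

definition quad4 :: "real tensor4 \<Rightarrow> real tensor2 \<Rightarrow> real" where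
  "quad4 S X = (\<Sum>\<alpha>\<in>UNIV. \<Sum>\<beta>\<in>UNIV. \<Sum>\<mu>\<in>UNIV. \<Sum>\<nu>\<in>UNIV. S$\<alpha>$\<beta>$\<mu>$\<nu> * X$\<alpha>$\<beta> * X$\<mu>$\<nu>)"

definition apply6 :: "real tensor6 \<Rightarrow> real tensor2 \<Rightarrow> real tensor2" where
  "apply6 R X = (\<chi> \<alpha> \<beta>. \<Sum>\<mu>\<in>UNIV. \<Sum>\<nu>\<in>UNIV. \<Sum>\<rho>\<in>UNIV. \<Sum>\<sigma>\<in>UNIV.
     R$\<alpha>$\<beta>$\<mu>$\<nu>$\<rho>$\<sigma> * X$\<mu>$\<nu> * X$\<rho>$\<sigma>)"

definition cubic6 :: "real tensor6 \<Rightarrow> real tensor2 \<Rightarrow> real" where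
  "cubic6 R X = (\<Sum>\<alpha>\<in>UNIV. \<Sum>\<beta>\<in>UNIV. apply6 R X $\<alpha>$\<beta> * X$\<alpha>$\<beta>)"

definition outer_vec :: "vect \<Rightarrow> vect \<Rightarrow> real tensor2" where
  "outer_vec x y = (\<chi> \<alpha> \<beta>. x$\<alpha> * y$\<beta>)"

definition outer_form :: "complex tensor2 \<Rightarrow> complex tensor2 \<Rightarrow> complex tensor4" where
  "outer_form A B = (\<chi> \<alpha> \<beta> \<mu> \<nu>. A$\<alpha>$\<beta> * B$\<mu>$\<nu>)"

end

theory Submission
  imports Defs
begin

text \<open>
  In an orthonormal coframe the forms \<open>F\<^sub>i = E\<^sub>i + \<i> M\<^sub>i\<close> (\<open>i = 1, 2, 3\<close>) span the self-dual 2-forms, so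
  \<open>\<W> = \<Sum> A\<^sub>i\<^sub>j F\<^sub>i \<otimes> F\<^sub>j\<close> with a symmetric complex 3x3 matrix \<open>A\<close>. The contractions \<open>S\<^sub>i\<^sub>k\<close> of \<open>F\<^sub>i\<close> with
  the conjugate of \<open>F\<^sub>k\<close> are orthogonal symmetric 2-tensors, hence the powers of \<open>T\<close> correspond to
  the powers of the Kronecker product of \<open>A\<close> with its conjugate. Therefore \<open>A^3 = 0 \<noteq> A^2\<close>, which
  forces \<open>A = \<lambda> (U L\<^sup>T + L U\<^sup>T)\<close> with \<open>L\<close> null, \<open>U\<close> a unit vector and \<open>U\<close> orthogonal to \<open>L\<close>. A spatial
  rotation followed by a null rotation turns \<open>L\<close> and \<open>U\<close> into \<open>l \<and> (m + \<i> n)\<close> and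
  \<open>l \<and> k + \<i> m \<and> n\<close> for a null tetrad \<open>(l, k, m, n)\<close>. There \<open>T\<close> is explicit and one computes
  \<open>\<Lambda> = 4 \<bar>\<lambda>\<bar>\<^sup>2 l \<otimes> l\<close>, \<open>h = m \<otimes> m + n \<otimes> n\<close> and \<open>v = - l \<otimes> k - k \<otimes> l\<close>, whatever the time-like vector \<open>u\<close>.
\<close>

section \<open>Components and determinants in dimension four\<close>

text \<open>In the tetrad \<open>T\<close> depends on \<lambda> only through the real constant c =
  2|\<lambda>|^2, so the phase of \<lambda> is lost; this is the duality rotation. The modulus
  returns in the scale of the recovered null vector, which is l times a real s with |s| =
  2|\<lambda>|; \<open>e\<close> carries the inverse factor, so that \<open>U\<close> is l \<and> k
  whatever s is. The vector \<open>w\<close> only selects a unit vector in the plane of m and n, and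
  turning that vector multiplies the self-dual form of l \<and> m by a phase, which goes into
  \<theta> as well. The square of \<open>T\<close> knows nothing but l, so the splitting of the
  metric into \<open>h\<close> and \<open>v\<close> must come from the factor N = l k + k l + m m +
  n n of \<open>T\<close> itself. Contractions of \<open>T\<close> with \<open>X\<close> mix N with
  l m, l n and l l terms that depend on \<open>u\<close>. The summands of \<open>R\<close> are
  balanced so that the l m and l n terms cancel and the l l coefficient becomes proportional to
  N(u,u); the subtraction in \<open>\<pi>\<close> then removes l l. The remaining -N/2 is free of
  \<open>u\<close>. The quotients make sense because l(u) is non-zero for time-like
  \<open>u\<close>.\<close>

lemma UNIV_4_eq: "(UNIV::4 set) = {0,1,2,3}"
proof -
  have "(4::4) = 0" by simp
  thus ?thesis using UNIV_4 by auto
qed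
lemma sum_UNIV_4: "(\<Sum>i\<in>(UNIV::4 set). f i) = f 0 + f 1 + f 2 + f 3"
  unfolding UNIV_4_eq by (simp add: add.assoc)
lemma forall_UNIV_4: "(\<forall>i::4. P i) \<longleftrightarrow> P 0 \<and> P 1 \<and> P 2 \<and> P 3"
  by (metis UNIV_4_eq UNIV_I insert_iff empty_iff)
lemma det_4:
  fixes A :: "'a::comm_ring_1^4^4"
  shows "det A =
   A$0$0*(A$1$1*(A$2$2*A$3$3-A$2$3*A$3$2) - A$1$2*(A$2$1*A$3$3-A$2$3*A$3$1) + A$1$3*(A$2$1*A$3$2-A$2$2*A$3$1))
  - A$0$1*(A$1$0*(A$2$2*A$3$3-A$2$3*A$3$2) - A$1$2*(A$2$0*A$3$3-A$2$3*A$3$0) + A$1$3*(A$2$0*A$3$2-A$2$2*A$3$0))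
  + A$0$2*(A$1$0*(A$2$1*A$3$3-A$2$3*A$3$1) - A$1$1*(A$2$0*A$3$3-A$2$3*A$3$0) + A$1$3*(A$2$0*A$3$1-A$2$1*A$3$0))
  - A$0$3*(A$1$0*(A$2$1*A$3$2-A$2$2*A$3$1) - A$1$1*(A$2$0*A$3$2-A$2$2*A$3$0) + A$1$2*(A$2$0*A$3$1-A$2$1*A$3$0))"
proof -
  have f: "finite {1::4,2,3}" "0 \<notin> {1::4,2,3}" "finite {2::4,3}" "1 \<notin> {2::4,3}" "finite {3::4}" "2 \<notin> {3::4}" by auto
  show ?thesis
  unfolding det_def UNIV_4_eq
  unfolding sum_over_permutations_insert[OF f(1,2)] sum_over_permutations_insert[OF f(3,4)] sum_over_permutations_insert[OF f(5,6)] permutes_sing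
  apply (simp add: sign_swap_id permutation_swap_id sign_compose sign_id swap_id_eq permutation_compose)
  apply (simp add: algebra_simps)
  done
qed

section \<open>Orthonormal coframes and the Hodge dual\<close>

text \<open>The volume form on four vectors, taken as rows. Duals of 2-forms are computed through it
  because it is multilinear and a change of basis \<open>M\<close> only multiplies it by
  \<open>det M\<close>.\<close>

definition vol4 :: "vect \<Rightarrow> vect \<Rightarrow> vect \<Rightarrow> vect \<Rightarrow> real" where
  "vol4 x y z w = det (\<chi> i. if i = 0 then x else if i = 1 then y else if i = 2 then z else w)"

lemma vol4_expand:
  "vol4 x y z w =
   x$0*(y$1*(z$2*w$3-z$3*w$2) - y$2*(z$1*w$3-z$3*w$1) + y$3*(z$1*w$2-z$2*w$1))
  - x$1*(y$0*(z$2*w$3-z$3*w$2) - y$2*(z$0*w$3-z$3*w$0) + y$3*(z$0*w$2-z$2*w$0))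
  + x$2*(y$0*(z$1*w$3-z$3*w$1) - y$1*(z$0*w$3-z$3*w$0) + y$3*(z$0*w$1-z$1*w$0))
  - x$3*(y$0*(z$1*w$2-z$2*w$1) - y$1*(z$0*w$2-z$2*w$0) + y$2*(z$0*w$1-z$1*w$0))"
  unfolding vol4_def det_4 by simp

lemma vol4_matrix_vector_mult:
  "vol4 (M *v x) (M *v y) (M *v z) (M *v w) = det M * vol4 x y z w"
proof -
  let ?R = "\<lambda>x y z w. (\<chi> i. if i = 0 then x else if i = 1 then y else if i = 2 then z else w) :: real^4^4"
  have "?R (M *v x) (M *v y) (M *v z) (M *v w) = ?R x y z w ** transpose M"
    by (simp add: vec_eq_iff matrix_matrix_mult_def matrix_vector_mult_def transpose_def mult.commute)
  then show ?thesis
    unfolding vol4_def by (simp add: det_mul mult.commute)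
qed

lemma levi_civita_eq: "levi_civita \<alpha> \<beta> \<mu> \<nu> = vol4 (axis \<alpha> 1) (axis \<beta> 1) (axis \<mu> 1) (axis \<nu> 1)"
  unfolding levi_civita_def vol4_def by (rule arg_cong[of _ _ det]) (simp add: vec_eq_iff)

lemma sum_levi_civita:
  "(\<Sum>\<mu>\<in>UNIV. \<Sum>\<nu>\<in>UNIV. levi_civita \<alpha> \<beta> \<mu> \<nu> * z$\<mu> * w$\<nu>) = vol4 (axis \<alpha> 1) (axis \<beta> 1) z w"
  unfolding levi_civita_eq sum_UNIV_4 vol4_expand axis_def by (simp add: algebra_simps)

lemma vol4_antisym: "vol4 x y w z = - vol4 x y z w"
  unfolding vol4_expand by (simp add: algebra_simps)

text \<open>The rows of \<open>\<Theta>\<close> are orthonormal covectors; the sign of \<open>det \<Theta>\<close> encodes positive orientation.\<close>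

definition coframe :: "real tensor2 \<Rightarrow> real \<Rightarrow> real^4^4 \<Rightarrow> bool" where
  "coframe g ori \<Theta> \<longleftrightarrow> transpose \<Theta> ** minkowski ** \<Theta> = g \<and> det \<Theta> = ori * sqrt \<bar>det g\<bar> \<and> det \<Theta> \<noteq> 0"

definition cowedge :: "vect \<Rightarrow> vect \<Rightarrow> real tensor2" where
  "cowedge x y = (\<chi> \<alpha> \<beta>. x$\<alpha> * y$\<beta> - y$\<alpha> * x$\<beta>)"

lemma matrix_inv_inverse:
  assumes "invertible A"
  shows "A ** matrix_inv A = mat 1" "matrix_inv A ** A = mat 1"
  using someI_ex[OF assms[unfolded invertible_def]] unfolding matrix_inv_def by auto

lemma minkowski_sq: "minkowski ** minkowski = mat 1"
  by (simp add: minkowski_def vec_eq_iff matrix_matrix_mult_def mat_def forall_UNIV_4 sum_UNIV_4)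

lemma transpose_minkowski: "transpose minkowski = minkowski"
  by (simp add: minkowski_def vec_eq_iff transpose_def)

lemma det_minkowski: "det minkowski = -1"
  unfolding det_4 by (simp add: minkowski_def)

text \<open>The inverse of an orthonormal basis is an orthonormal coframe, possibly of the wrong
  orientation; in that case one spatial covector is reversed.\<close>

lemma coframe_exists:
  assumes "lorentzian g" "ori = 1 \<or> ori = -1"
  obtains \<Theta> where "coframe g ori \<Theta>"
proof -
  obtain P where P: "invertible P" "transpose P ** g ** P = minkowski"
    using assms(1) unfolding lorentzian_def by blast
  define Q where "Q = matrix_inv P"
  have Q: "P ** Q = mat 1" "Q ** P = mat 1"
    unfolding Q_def using matrix_inv_inverse[OF P(1)] by auto
  have g: "transpose Q ** minkowski ** Q = g"
  proof -
    have "transpose Q ** minkowski ** Q = (transpose Q ** transpose P) ** g ** (P ** Q)"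
      unfolding P(2)[symmetric] by (simp add: matrix_mul_assoc)
    then show ?thesis
      by (simp add: Q(1) matrix_transpose_mul[symmetric])
  qed
  have dQ: "det Q \<noteq> 0"
    using Q(1) by (metis det_I det_mul mult_zero_right zero_neq_one)
  have dg: "sqrt \<bar>det g\<bar> = \<bar>det Q\<bar>"
    unfolding g[symmetric] by (simp add: det_mul det_minkowski abs_mult real_sqrt_mult)
  define D :: "real^4^4" where "D = (\<chi> i j. if i = j then (if i = 3 then -1 else 1) else 0)"
  have D: "transpose D ** minkowski ** D = minkowski" "det D = -1"
    unfolding det_4 by (simp_all add: D_def minkowski_def transpose_def vec_eq_iff matrix_matrix_mult_def forall_UNIV_4 sum_UNIV_4)
  have gD: "transpose (D ** Q) ** minkowski ** (D ** Q) = g"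
  proof -
    have "transpose (D ** Q) ** minkowski ** (D ** Q) = transpose Q ** (transpose D ** minkowski ** D) ** Q"
      by (simp add: matrix_transpose_mul matrix_mul_assoc)
    then show ?thesis using D(1) g by simp
  qed
  have "coframe g ori Q \<or> coframe g ori (D ** Q)"
    using g gD dQ assms(2) unfolding coframe_def dg det_mul D(2) by (auto simp: abs_if)
  then show ?thesis using that by blast
qed

lemma coframe_inverse_metric:
  assumes "coframe g ori \<Theta>"
  shows "\<Theta> ** matrix_inv g ** transpose \<Theta> = minkowski"
    and "g ** matrix_inv g = mat 1" and "matrix_inv g ** g = mat 1"
proof -
  have inv: "invertible \<Theta>" using assms unfolding coframe_def invertible_det_nz by blast
  define P where "P = matrix_inv \<Theta>"
  have P: "P ** \<Theta> = mat 1" "\<Theta> ** P = mat 1"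
    unfolding P_def using matrix_inv_inverse[OF inv] by auto
  have g: "g = transpose \<Theta> ** minkowski ** \<Theta>" using assms unfolding coframe_def by metis
  have "det g = - (det \<Theta> * det \<Theta>)" unfolding g by (simp add: det_mul det_minkowski)
  moreover have "det \<Theta> \<noteq> 0" using assms unfolding coframe_def by blast
  ultimately have "det g \<noteq> 0" by simp
  then have ig: "invertible g" by (simp add: invertible_det_nz)
  show 1: "g ** matrix_inv g = mat 1" and 2: "matrix_inv g ** g = mat 1"
    using matrix_inv_inverse[OF ig] by auto
  have "minkowski ** \<Theta> ** matrix_inv g ** transpose \<Theta> = transpose P ** (g ** matrix_inv g) ** transpose \<Theta>"
  proof -
    have "transpose P ** transpose \<Theta> = mat 1" by (simp add: matrix_transpose_mul[symmetric] P)
    then have "transpose P ** g = minkowski ** \<Theta>"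
      unfolding g by (simp add: matrix_mul_assoc)
    then show ?thesis by (simp add: matrix_mul_assoc)
  qed
  also have "\<dots> = mat 1" by (simp add: 1 matrix_transpose_mul[symmetric] P)
  finally have "minkowski ** (minkowski ** \<Theta> ** matrix_inv g ** transpose \<Theta>) = minkowski" by simp
  then show "\<Theta> ** matrix_inv g ** transpose \<Theta> = minkowski"
    by (simp add: matrix_mul_assoc minkowski_sq)
qed

text \<open>Raising the index of a coframe covector gives a vector \<open>e a\<close> whose coframe
  components are row \<open>a\<close> of \<open>minkowski\<close>. The prefactor of the volume
  element is \<open>det \<Theta>\<close>, so multiplicativity of the determinant moves the whole
  expression into the coframe, where two of the four arguments are constant.\<close>

lemma hodge2_cowedge:
  assumes "coframe g ori \<Theta>"
  shows "hodge2 g ori (cowedge (\<Theta>$a) (\<Theta>$b)) $\<alpha>$\<beta> =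
    vol4 (column \<alpha> \<Theta>) (column \<beta> \<Theta>) (minkowski$a) (minkowski$b)"
proof -
  define e where "e a = matrix_inv g *v \<Theta>$a" for a
  have e: "\<Theta> *v e a = minkowski $ a" for a
  proof -
    have "\<Theta> *v e a = column a (\<Theta> ** matrix_inv g ** transpose \<Theta>)"
      by (simp add: e_def vec_eq_iff column_def transpose_def matrix_matrix_mult_def matrix_vector_mul_assoc)
        (simp add: matrix_matrix_mult_def matrix_vector_mult_def)
    also have "\<dots> = minkowski $ a"
      unfolding coframe_inverse_metric(1)[OF assms] by (simp add: column_def vec_eq_iff minkowski_def)
    finally show ?thesis .
  qed
  have ax: "\<Theta> *v axis \<alpha> 1 = column \<alpha> \<Theta>" for \<alpha>
    by (simp add: matrix_vector_mult_basis)
  have raise: "(\<Sum>\<rho>\<in>UNIV. \<Sum>\<sigma>\<in>UNIV. c * matrix_inv g $\<mu>$\<rho> * matrix_inv g $\<nu>$\<sigma> * cowedge (\<Theta>$a) (\<Theta>$b) $\<rho>$\<sigma>)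
     = c * e a$\<mu> * e b$\<nu> - c * e b$\<mu> * e a$\<nu>" for c \<mu> \<nu>
    unfolding e_def matrix_vector_mult_def cowedge_def sum_UNIV_4
    by (simp add: algebra_simps)
  have "hodge2 g ori (cowedge (\<Theta>$a) (\<Theta>$b)) $\<alpha>$\<beta> = 1/2 * (\<Sum>\<mu>\<in>UNIV. \<Sum>\<nu>\<in>UNIV.
     volume_element g ori $\<alpha>$\<beta>$\<mu>$\<nu> * e a$\<mu> * e b$\<nu> - volume_element g ori $\<alpha>$\<beta>$\<mu>$\<nu> * e b$\<mu> * e a$\<nu>)"
    unfolding hodge2_def by (simp add: raise)
  also have "\<dots> = 1/2 * (ori * sqrt \<bar>det g\<bar>) *
     ((\<Sum>\<mu>\<in>UNIV. \<Sum>\<nu>\<in>UNIV. levi_civita \<alpha> \<beta> \<mu> \<nu> * e a$\<mu> * e b$\<nu>) -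
      (\<Sum>\<mu>\<in>UNIV. \<Sum>\<nu>\<in>UNIV. levi_civita \<alpha> \<beta> \<mu> \<nu> * e b$\<mu> * e a$\<nu>))"
    by (simp add: volume_element_def sum_subtractf[symmetric] sum_distrib_left algebra_simps)
  also have "\<dots> = det \<Theta> * vol4 (axis \<alpha> 1) (axis \<beta> 1) (e a) (e b)"
    unfolding sum_levi_civita using assms
    by (simp add: coframe_def vol4_antisym[of _ _ "e b" "e a"])
  also have "\<dots> = vol4 (column \<alpha> \<Theta>) (column \<beta> \<Theta>) (minkowski$a) (minkowski$b)"
    by (simp add: vol4_matrix_vector_mult[symmetric] e ax)
  finally show ?thesis .
qed

text \<open>Coframe index of a spatial direction; in type \<^typ>\<open>3\<close>, \<open>i + 1\<close> and \<open>i + 2\<close> are the cyclic successors.\<close>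

definition sp_idx :: "3 \<Rightarrow> 4" where "sp_idx i = (if i = 1 then 1 else if i = 2 then 2 else 3)"

definition electric :: "real^4^4 \<Rightarrow> 3 \<Rightarrow> real tensor2" where
  "electric \<Theta> i = cowedge (\<Theta>$0) (\<Theta>$sp_idx i)"
definition magnetic :: "real^4^4 \<Rightarrow> 3 \<Rightarrow> real tensor2" where
  "magnetic \<Theta> i = cowedge (\<Theta>$sp_idx (i+1)) (\<Theta>$sp_idx (i+2))"

lemma hodge2_electric:
  assumes "coframe g ori \<Theta>"
  shows "hodge2 g ori (electric \<Theta> i) = - magnetic \<Theta> i"
  unfolding vec_eq_iff electric_def magnetic_def hodge2_cowedge[OF assms]
  using exhaust_3[of i] by (auto simp: sp_idx_def vol4_expand minkowski_def column_def cowedge_def)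

lemma hodge2_magnetic:
  assumes "coframe g ori \<Theta>"
  shows "hodge2 g ori (magnetic \<Theta> i) = electric \<Theta> i"
  unfolding vec_eq_iff electric_def magnetic_def hodge2_cowedge[OF assms]
  using exhaust_3[of i] by (auto simp: sp_idx_def vol4_expand minkowski_def column_def cowedge_def)

lemma linear_hodge2: "linear (hodge2 g ori)"
  by (rule linearI)
    (simp_all add: hodge2_def vec_eq_iff sum.distrib sum_distrib_left algebra_simps)

lemma coframe_cancel:
  assumes "coframe g ori \<Theta>"
  shows "matrix_inv \<Theta> ** \<Theta> = mat 1" "\<Theta> ** matrix_inv \<Theta> = mat 1"
  using matrix_inv_inverse[of \<Theta>] assms unfolding coframe_def invertible_det_nz by blast+

lemma sp_idx_simps: "sp_idx 0 = 3" "sp_idx 1 = 1" "sp_idx 2 = 2" "sp_idx 3 = 3" "sp_idx (1+1) = 2" "sp_idx (1+2) = 3" "sp_idx (2+1) = 3" "sp_idx (2+2) = 1" "sp_idx 4 = 1" "sp_idx 5 = 2"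
proof -
  have "(5::3) = 2" by simp
  then show "sp_idx 5 = 2" by (simp only: sp_idx_def) simp
qed (simp_all add: sp_idx_def)

section \<open>Expansion of 2-forms in the electric and magnetic basis\<close>

abbreviation pull :: "real^4^4 \<Rightarrow> real tensor2 \<Rightarrow> real tensor2" where
  "pull P F \<equiv> transpose P ** F ** P"

lemma pull_nth: "pull P F $a$b = (\<Sum>\<beta>\<in>UNIV. \<Sum>\<alpha>\<in>UNIV. P$\<alpha>$a * F$\<alpha>$\<beta> * P$\<beta>$b)"
  by (simp add: matrix_matrix_mult_def transpose_def sum_distrib_right)

text \<open>\<open>pull (matrix_inv \<Theta>) F\<close> lists the coframe components of
  \<open>F\<close>; antisymmetry leaves the pairs (0,i) and the three cyclic spatial pairs.\<close>

lemma antisym_decomposition: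
  assumes "coframe g ori \<Theta>" and anti: "\<And>\<alpha> \<beta>. F$\<alpha>$\<beta> = - F$\<beta>$\<alpha>"
  shows "F = (\<Sum>i\<in>UNIV. pull (matrix_inv \<Theta>) F $0$sp_idx i *\<^sub>R electric \<Theta> i
     + pull (matrix_inv \<Theta>) F $sp_idx (i+1)$sp_idx (i+2) *\<^sub>R magnetic \<Theta> i)"
proof -
  define G where "G = pull (matrix_inv \<Theta>) F"
  have "transpose F $a$b = (- F)$a$b" for a b using anti[of b a] by (simp add: transpose_def)
  then have "transpose F = - F" by (simp add: vec_eq_iff)
  then have tG: "transpose G = - G"
    by (simp add: G_def matrix_transpose_mul matrix_mul_assoc)
      (simp add: matrix_matrix_mult_def vec_eq_iff sum_negf)
  have G: "G$b$a = - G$a$b" for a b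
  proof -
    have "G$b$a = transpose G $a$b" by (simp add: transpose_def)
    then show ?thesis unfolding tG by simp
  qed
  have G0: "G$a$a = 0" for a using G[of a a] by simp
  have "F = transpose (matrix_inv \<Theta> ** \<Theta>) ** F ** (matrix_inv \<Theta> ** \<Theta>)"
    by (simp add: coframe_cancel[OF assms(1)])
  also have "\<dots> = pull \<Theta> G"
    by (simp add: G_def matrix_transpose_mul matrix_mul_assoc)
  also have "\<dots> = (\<Sum>i\<in>UNIV. G $0$sp_idx i *\<^sub>R electric \<Theta> i + G $sp_idx (i+1)$sp_idx (i+2) *\<^sub>R magnetic \<Theta> i)"
  proof -
    have "pull \<Theta> G $\<alpha>$\<beta> = (\<Sum>i\<in>UNIV. G $0$sp_idx i *\<^sub>R electric \<Theta> i + G $sp_idx (i+1)$sp_idx (i+2) *\<^sub>R magnetic \<Theta> i)$\<alpha>$\<beta>" for \<alpha> \<beta>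
      unfolding pull_nth UNIV_3
      apply (simp add: sum_UNIV_4 electric_def magnetic_def cowedge_def sp_idx_simps G0
         G[of 0 1] G[of 0 2] G[of 0 3] G[of 1 2] G[of 2 3] G[of 3 1])
      apply (simp add: algebra_simps)
      done
    then show ?thesis by (simp add: vec_eq_iff)
  qed
  finally show ?thesis by (simp add: G_def)
qed

definition sd_form :: "real^4^4 \<Rightarrow> 3 \<Rightarrow> complex tensor2" where
  "sd_form \<Theta> i = (\<chi> \<alpha> \<beta>. Complex (electric \<Theta> i $\<alpha>$\<beta>) (magnetic \<Theta> i $\<alpha>$\<beta>))"

text \<open>Since the duals of E and M are -M and E, the map F - \<i> *F sends E to E + \<i> M and M
  to -\<i> (E + \<i> M). Both basis forms contribute to the same self-dual form, with total
  coefficient x - \<i> y.\<close>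

lemma self_dual_part:
  assumes "coframe g ori \<Theta>" and anti: "\<And>\<alpha> \<beta>. F$\<alpha>$\<beta> = - F$\<beta>$\<alpha>"
  shows "complex_of_real (F$\<alpha>$\<beta>) - \<i> * complex_of_real (hodge2 g ori F $\<alpha>$\<beta>) =
    (\<Sum>i\<in>UNIV. Complex (pull (matrix_inv \<Theta>) F $0$sp_idx i) (- pull (matrix_inv \<Theta>) F $sp_idx (i+1)$sp_idx (i+2)) * sd_form \<Theta> i $\<alpha>$\<beta>)"
proof -
  define x y where "x i = pull (matrix_inv \<Theta>) F $0$sp_idx i"
    and "y i = pull (matrix_inv \<Theta>) F $sp_idx (i+1)$sp_idx (i+2)" for i
  have F: "F = (\<Sum>i\<in>UNIV. x i *\<^sub>R electric \<Theta> i + y i *\<^sub>R magnetic \<Theta> i)"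
    unfolding x_def y_def by (rule antisym_decomposition[OF assms])
  have H: "hodge2 g ori F = (\<Sum>i\<in>UNIV. y i *\<^sub>R electric \<Theta> i + x i *\<^sub>R - magnetic \<Theta> i)"
  proof -
    have "hodge2 g ori F = hodge2 g ori (\<Sum>i\<in>UNIV. x i *\<^sub>R electric \<Theta> i + y i *\<^sub>R magnetic \<Theta> i)"
      using F by (rule arg_cong)
    also have "\<dots> = (\<Sum>i\<in>UNIV. x i *\<^sub>R hodge2 g ori (electric \<Theta> i) + y i *\<^sub>R hodge2 g ori (magnetic \<Theta> i))"
      by (simp only: linear_sum[OF linear_hodge2] linear_add[OF linear_hodge2] linear_scale[OF linear_hodge2])
    finally show ?thesis
      by (simp only: hodge2_electric[OF assms(1)] hodge2_magnetic[OF assms(1)] add.commute)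
  qed
  have F': "F$\<alpha>$\<beta> = (\<Sum>i\<in>UNIV. x i * electric \<Theta> i $\<alpha>$\<beta> + y i * magnetic \<Theta> i $\<alpha>$\<beta>)"
    using arg_cong[OF F, of "\<lambda>F. F$\<alpha>$\<beta>"] by (simp add: sum_component)
  have H': "hodge2 g ori F $\<alpha>$\<beta> = (\<Sum>i\<in>UNIV. y i * electric \<Theta> i $\<alpha>$\<beta> - x i * magnetic \<Theta> i $\<alpha>$\<beta>)"
    unfolding H by (simp add: sum_component)
  show ?thesis
    unfolding F' H' x_def[symmetric] y_def[symmetric] of_real_sum sum_distrib_left sum_subtractf[symmetric]
    by (rule sum.cong) (simp_all add: sd_form_def complex_eq_iff)
qed

lemma sum_UNIV_4_swap:
  "(\<Sum>a\<in>A. \<Sum>b\<in>B. \<Sum>c\<in>C. \<Sum>d\<in>D. f a b c d) = (\<Sum>c\<in>C. \<Sum>d\<in>D. \<Sum>a\<in>A. \<Sum>b\<in>B. f a b c d)"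
proof -
  have "(\<Sum>a\<in>A. \<Sum>b\<in>B. \<Sum>c\<in>C. \<Sum>d\<in>D. f a b c d) = (\<Sum>a\<in>A. \<Sum>c\<in>C. \<Sum>d\<in>D. \<Sum>b\<in>B. f a b c d)"
    by (rule sum.cong[OF refl], subst sum.swap, rule sum.cong[OF refl], rule sum.swap)
  also have "\<dots> = (\<Sum>c\<in>C. \<Sum>d\<in>D. \<Sum>a\<in>A. \<Sum>b\<in>B. f a b c d)"
    by (subst sum.swap, rule sum.cong[OF refl], rule sum.swap)
  finally show ?thesis .
qed

section \<open>The self-dual Weyl tensor as a symmetric complex matrix\<close>

text \<open>Left and right dual of \<open>W\<close> agree; the trace condition is what makes this true.\<close>

lemma weyl_frame_relations:
  fixes w :: "4 \<Rightarrow> 4 \<Rightarrow> 4 \<Rightarrow> 4 \<Rightarrow> real" and i j :: 3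
  assumes a1: "\<And>a b c d. w b a c d = - w a b c d"
    and a2: "\<And>a b c d. w a b d c = - w a b c d"
    and ps: "\<And>a b c d. w a b c d = w c d a b"
    and tr: "\<And>b d. - w 0 b 0 d + w 1 b 1 d + w 2 b 2 d + w 3 b 3 d = 0"
  shows "w (sp_idx (i+1)) (sp_idx (i+2)) 0 (sp_idx j) = w 0 (sp_idx i) (sp_idx (j+1)) (sp_idx (j+2))" (is ?A)
    and "w (sp_idx (i+1)) (sp_idx (i+2)) (sp_idx (j+1)) (sp_idx (j+2)) = - w 0 (sp_idx i) 0 (sp_idx j)" (is ?B)
proof -
  have z: "w a a c d = 0" "w a b c c = 0" for a b c d using a1[of a a c d] a2[of a b c c] by auto
  \<comment> \<open>These equations orient each index pair to one of 01, 02, 03, 12, 23, 31 and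
    order the two pairs, so that the ten trace conditions become linear equations in the remaining
    components.\<close>
  note n = z a1[of 1 0] a1[of 2 0] a1[of 3 0] a1[of 2 1] a1[of 3 2] a1[of 1 3]
    a2[of _ _ 1 0] a2[of _ _ 2 0] a2[of _ _ 3 0] a2[of _ _ 2 1] a2[of _ _ 3 2] a2[of _ _ 1 3]
    ps[of 0 2 0 1] ps[of 0 3 0 1] ps[of 0 3 0 2] ps[of 1 2 0 1] ps[of 1 2 0 2] ps[of 1 2 0 3]
    ps[of 2 3 0 1] ps[of 2 3 0 2] ps[of 2 3 0 3] ps[of 3 1 0 1] ps[of 3 1 0 2] ps[of 3 1 0 3]
    ps[of 2 3 1 2] ps[of 3 1 1 2] ps[of 3 1 2 3]
  note t = tr[of 0 0] tr[of 0 1] tr[of 0 2] tr[of 0 3] tr[of 1 1] tr[of 1 2] tr[of 1 3] tr[of 2 2] tr[of 2 3] tr[of 3 3]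
  note t' = t[simplified n, simplified]
  have "?A \<and> ?B"
    using exhaust_3[of i] exhaust_3[of j]
    apply (elim disjE)
    apply (simp_all add: sp_idx_simps n)
    using t' apply linarith+
    done
  then show ?A ?B by auto
qed

lemma sum_sum_swap4:
  "(\<Sum>a\<in>A. \<Sum>b\<in>B. \<Sum>c\<in>C. \<Sum>d\<in>D. f a b c d) = (\<Sum>b\<in>B. \<Sum>d\<in>D. \<Sum>a\<in>A. \<Sum>c\<in>C. f a b c d)"
proof -
  have "(\<Sum>a\<in>A. \<Sum>b\<in>B. \<Sum>c\<in>C. \<Sum>d\<in>D. f a b c d) = (\<Sum>a\<in>A. \<Sum>b\<in>B. \<Sum>d\<in>D. \<Sum>c\<in>C. f a b c d)"
    by (intro sum.cong refl sum.swap)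
  also have "\<dots> = (\<Sum>b\<in>B. \<Sum>a\<in>A. \<Sum>d\<in>D. \<Sum>c\<in>C. f a b c d)" by (rule sum.swap)
  also have "\<dots> = (\<Sum>b\<in>B. \<Sum>d\<in>D. \<Sum>a\<in>A. \<Sum>c\<in>C. f a b c d)" by (intro sum.cong refl sum.swap)
  finally show ?thesis .
qed

lemma coframe_matrix_inv:
  assumes "coframe g ori \<Theta>"
  shows "matrix_inv g = matrix_inv \<Theta> ** minkowski ** transpose (matrix_inv \<Theta>)"
proof -
  have "matrix_inv \<Theta> ** minkowski ** transpose (matrix_inv \<Theta>)
      = (matrix_inv \<Theta> ** \<Theta>) ** matrix_inv g ** transpose (matrix_inv \<Theta> ** \<Theta>)"
    unfolding coframe_inverse_metric(1)[OF assms, symmetric] by (simp add: matrix_mul_assoc matrix_transpose_mul)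
  then show ?thesis by (simp add: coframe_cancel[OF assms])
qed

text \<open>Taking the self-dual part in the first index pair leaves coefficients that are complex
  2-forms in the second pair. The frame relations make these self-dual too, so they expand in the
  same three forms. Up to sign and the factor 1/2, the real and imaginary parts of the matrix are
  the electric and magnetic parts of \<open>W\<close>.\<close>

lemma self_dual_weyl_expansion:
  assumes cf: "coframe g ori \<Theta>" and W: "weyl_tensor g W"
  obtains A :: "complex^3^3" where "transpose A = A"
    "\<And>\<alpha> \<beta> \<mu> \<nu>. self_dual_weyl g ori W $\<alpha>$\<beta>$\<mu>$\<nu> =
      (\<Sum>i\<in>UNIV. \<Sum>j\<in>UNIV. A$i$j * sd_form \<Theta> i $\<alpha>$\<beta> * sd_form \<Theta> j $\<mu>$\<nu>)"
proof -
  define P where "P = matrix_inv \<Theta>"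
  define w where "w a b c d = (\<Sum>\<alpha>\<in>UNIV. \<Sum>\<beta>\<in>UNIV. \<Sum>\<mu>\<in>UNIV. \<Sum>\<nu>\<in>UNIV.
     P$\<alpha>$a * P$\<beta>$b * P$\<mu>$c * P$\<nu>$d * W$\<alpha>$\<beta>$\<mu>$\<nu>)" for a b c d
  have W1: "W$\<alpha>$\<beta>$\<mu>$\<nu> = - W$\<beta>$\<alpha>$\<mu>$\<nu>" and W2: "W$\<alpha>$\<beta>$\<mu>$\<nu> = - W$\<alpha>$\<beta>$\<nu>$\<mu>"
    and W3: "W$\<alpha>$\<beta>$\<mu>$\<nu> = W$\<mu>$\<nu>$\<alpha>$\<beta>" for \<alpha> \<beta> \<mu> \<nu>
    using W unfolding weyl_tensor_def by blast+
  have W4: "(\<Sum>\<alpha>\<in>UNIV. \<Sum>\<mu>\<in>UNIV. matrix_inv g $\<alpha>$\<mu> * W$\<alpha>$\<beta>$\<mu>$\<nu>) = 0" for \<beta> \<nu>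
    using W unfolding weyl_tensor_def by blast
  have ps: "w a b c d = w c d a b" for a b c d
    unfolding w_def
    by (subst sum_UNIV_4_swap, intro sum.cong refl, subst W3) (simp only: mult_ac)
  have a1: "w b a c d = - w a b c d" for a b c d
    unfolding w_def sum_negf[symmetric]
    by (subst sum.swap, intro sum.cong refl, subst W1) (simp only: mult_ac minus_mult_right)
  have a2: "w a b d c = - w a b c d" for a b c d
    using a1[of d c a b] ps by metis
  have tr: "- w 0 b 0 d + w 1 b 1 d + w 2 b 2 d + w 3 b 3 d = 0" for b d
  proof -
    have gi: "matrix_inv g $\<alpha>$\<mu> = - P$\<alpha>$0 * P$\<mu>$0 + P$\<alpha>$1 * P$\<mu>$1 + P$\<alpha>$2 * P$\<mu>$2 + P$\<alpha>$3 * P$\<mu>$3" for \<alpha> \<mu>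
      unfolding coframe_matrix_inv[OF cf] P_def[symmetric]
      by (simp add: matrix_matrix_mult_def transpose_def sum_UNIV_4 minkowski_def)
    have "0 = (\<Sum>\<beta>\<in>UNIV. \<Sum>\<nu>\<in>UNIV. P$\<beta>$b * P$\<nu>$d * (\<Sum>\<alpha>\<in>UNIV. \<Sum>\<mu>\<in>UNIV. matrix_inv g $\<alpha>$\<mu> * W$\<alpha>$\<beta>$\<mu>$\<nu>))"
      unfolding W4 by simp
    also have "\<dots> = (\<Sum>\<alpha>\<in>UNIV. \<Sum>\<beta>\<in>UNIV. \<Sum>\<mu>\<in>UNIV. \<Sum>\<nu>\<in>UNIV. P$\<beta>$b * P$\<nu>$d * (matrix_inv g $\<alpha>$\<mu> * W$\<alpha>$\<beta>$\<mu>$\<nu>))"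
      unfolding sum_distrib_left by (rule sum_sum_swap4[symmetric])
    also have "\<dots> = - w 0 b 0 d + w 1 b 1 d + w 2 b 2 d + w 3 b 3 d"
      unfolding gi w_def sum_negf[symmetric] sum.distrib[symmetric]
      by (intro sum.cong refl) (simp add: algebra_simps)
    finally show ?thesis by simp
  qed
  note rel = weyl_frame_relations[of w, OF a1 a2 ps tr]
  define Wm where "Wm \<mu> \<nu> = (\<chi> \<alpha> \<beta>. W$\<alpha>$\<beta>$\<mu>$\<nu>)" for \<mu> \<nu>
  have Wm: "Wm \<mu> \<nu> $\<alpha>$\<beta> = - Wm \<mu> \<nu> $\<beta>$\<alpha>" for \<alpha> \<beta> \<mu> \<nu>
    using W1[of \<alpha> \<beta> \<mu> \<nu>] by (simp add: Wm_def)
  \<comment> \<open>The first index pair is in coframe components, the second still in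
    coordinates.\<close>
  define X where "X a b = (\<chi> \<mu> \<nu>. pull P (Wm \<mu> \<nu>) $a$b)" for a b
  have Xa: "X a b $\<mu>$\<nu> = - X a b $\<nu>$\<mu>" for a b \<mu> \<nu>
  proof -
    have "Wm \<mu> \<nu> $\<alpha>$\<beta> = - (Wm \<nu> \<mu> $\<alpha>$\<beta>)" for \<alpha> \<beta>
      using W2[of \<alpha> \<beta> \<mu> \<nu>] by (simp add: Wm_def)
    then have "Wm \<mu> \<nu> = - Wm \<nu> \<mu>" by (simp add: vec_eq_iff)
    then show ?thesis by (simp add: X_def pull_nth sum_negf)
  qed
  have Xw: "pull P (X a b) $c$d = w a b c d" for a b c d
  proof -
    have "pull P (X a b) $c$d = (\<Sum>\<nu>\<in>UNIV. \<Sum>\<mu>\<in>UNIV. \<Sum>\<beta>\<in>UNIV. \<Sum>\<alpha>\<in>UNIV.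
        P$\<alpha>$a * P$\<beta>$b * P$\<mu>$c * P$\<nu>$d * W$\<alpha>$\<beta>$\<mu>$\<nu>)"
      unfolding pull_nth X_def vec_lambda_beta Wm_def sum_distrib_left sum_distrib_right
      by (intro sum.cong refl) simp
    also have "\<dots> = (\<Sum>\<mu>\<in>UNIV. \<Sum>\<nu>\<in>UNIV. \<Sum>\<alpha>\<in>UNIV. \<Sum>\<beta>\<in>UNIV.
        P$\<alpha>$a * P$\<beta>$b * P$\<mu>$c * P$\<nu>$d * W$\<alpha>$\<beta>$\<mu>$\<nu>)"
      by (subst sum.swap) (intro sum.cong refl sum.swap)
    finally show ?thesis unfolding w_def by (subst sum_UNIV_4_swap)
  qed
  define A :: "complex^3^3" where "A = (\<chi> i j. Complex (w 0 (sp_idx i) 0 (sp_idx j)) (- w (sp_idx (i+1)) (sp_idx (i+2)) 0 (sp_idx j)) / 2)"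
  have "A$i$j = A$j$i" for i j
    using rel(1)[of i j] ps[of 0 "sp_idx i" 0 "sp_idx j"] ps[of 0 "sp_idx i" "sp_idx (j+1)" "sp_idx (j+2)"] by (simp add: A_def)
  then have sym: "transpose A = A" by (simp add: vec_eq_iff transpose_def)
  \<comment> \<open>The frame relations enter here: they make the \<open>electric\<close> and
    \<open>magnetic\<close> terms combine into multiples of \<open>sd_form\<close>.\<close>
  have E: "Complex (X 0 (sp_idx i) $\<mu>$\<nu>) (- X (sp_idx (i+1)) (sp_idx (i+2)) $\<mu>$\<nu>) / 2 = (\<Sum>j\<in>UNIV. A$i$j * sd_form \<Theta> j $\<mu>$\<nu>)" for i \<mu> \<nu>
  proof -
    have X: "X a b $\<mu>$\<nu> = (\<Sum>j\<in>UNIV. w a b 0 (sp_idx j) * electric \<Theta> j $\<mu>$\<nu>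
        + w a b (sp_idx (j+1)) (sp_idx (j+2)) * magnetic \<Theta> j $\<mu>$\<nu>)" for a b
      using arg_cong[OF antisym_decomposition[OF cf Xa, unfolded P_def[symmetric] Xw], of "\<lambda>F. F$\<mu>$\<nu>"]
      by (simp add: sum_component)
    show ?thesis unfolding X
      by (simp add: rel complex_eq_iff A_def sd_form_def sum_negf sum.distrib sum_subtractf sum_divide_distrib add_divide_distrib diff_divide_distrib)
  qed
  have "self_dual_weyl g ori W $\<alpha>$\<beta>$\<mu>$\<nu> =
      (\<Sum>i\<in>UNIV. \<Sum>j\<in>UNIV. A$i$j * sd_form \<Theta> i $\<alpha>$\<beta> * sd_form \<Theta> j $\<mu>$\<nu>)" for \<alpha> \<beta> \<mu> \<nu>
  proof -
    have "self_dual_weyl g ori W $\<alpha>$\<beta>$\<mu>$\<nu> = 1/2 * (complex_of_real (Wm \<mu> \<nu> $\<alpha>$\<beta>) -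
       \<i> * complex_of_real (hodge2 g ori (Wm \<mu> \<nu>) $\<alpha>$\<beta>))"
    proof -
      have "hodge4 g ori W $\<alpha>$\<beta>$\<mu>$\<nu> = hodge2 g ori (Wm \<mu> \<nu>) $\<alpha>$\<beta>"
        unfolding hodge4_def hodge2_def Wm_def vec_lambda_beta by (subst sum_UNIV_4_swap) (rule refl)
      then show ?thesis by (simp add: self_dual_weyl_def Wm_def)
    qed
    also have "\<dots> = 1/2 * (\<Sum>i\<in>UNIV. Complex (X 0 (sp_idx i) $\<mu>$\<nu>) (- X (sp_idx (i+1)) (sp_idx (i+2)) $\<mu>$\<nu>) * sd_form \<Theta> i $\<alpha>$\<beta>)"
      unfolding self_dual_part[OF cf Wm] P_def[symmetric] by (simp add: X_def)
    also have "\<dots> = (\<Sum>i\<in>UNIV. (Complex (X 0 (sp_idx i) $\<mu>$\<nu>) (- X (sp_idx (i+1)) (sp_idx (i+2)) $\<mu>$\<nu>) / 2) * sd_form \<Theta> i $\<alpha>$\<beta>)"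
      by (simp add: sum_distrib_left)
    also have "\<dots> = (\<Sum>i\<in>UNIV. \<Sum>j\<in>UNIV. A$i$j * sd_form \<Theta> i $\<alpha>$\<beta> * sd_form \<Theta> j $\<mu>$\<nu>)"
      unfolding E by (simp add: sum_distrib_left sum_distrib_right mult_ac)
    finally show ?thesis .
  qed
  with sym show ?thesis using that by blast
qed

section \<open>The Bel-Robinson tensor in terms of the matrix\<close>

definition cmat :: "real^4^4 \<Rightarrow> complex^4^4" where
  "cmat M = (\<chi> a b. complex_of_real (M$a$b))"

definition cnjmat :: "complex^4^4 \<Rightarrow> complex^4^4" where
  "cnjmat M = (\<chi> a b. cnj (M$a$b))"

lemma cmat_mult: "cmat (A ** B) = cmat A ** cmat B"
  by (simp add: cmat_def vec_eq_iff matrix_matrix_mult_def)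

lemma cmat_transpose: "cmat (transpose A) = transpose (cmat A)"
  by (simp add: cmat_def vec_eq_iff transpose_def)

text \<open>Contraction through \<open>G\<close>, bilinear rather than sesquilinear; conjugates are
  written out where they occur. The arguments are functions so that a tensor with some indices held
  fixed can be inserted.\<close>

definition bform :: "real tensor2 \<Rightarrow> (4 \<Rightarrow> complex) \<Rightarrow> (4 \<Rightarrow> complex) \<Rightarrow> complex" where
  "bform G x y = (\<Sum>\<rho>\<in>UNIV. \<Sum>\<kappa>\<in>UNIV. x \<kappa> * of_real (G$\<kappa>$\<rho>) * y \<rho>)"

definition bform2 :: "real tensor2 \<Rightarrow> (4 \<Rightarrow> 4 \<Rightarrow> complex) \<Rightarrow> (4 \<Rightarrow> 4 \<Rightarrow> complex) \<Rightarrow> complex" where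
  "bform2 G X Y = (\<Sum>\<mu>\<in>UNIV. \<Sum>\<nu>\<in>UNIV. \<Sum>\<kappa>\<in>UNIV. \<Sum>\<tau>\<in>UNIV.
     X \<kappa> \<tau> * of_real (G$\<kappa>$\<mu>) * of_real (G$\<tau>$\<nu>) * Y \<mu> \<nu>)"

lemma bform2_sum_left: "finite I \<Longrightarrow> bform2 G (\<lambda>\<kappa> \<tau>. \<Sum>i\<in>I. X i \<kappa> \<tau>) Y = (\<Sum>i\<in>I. bform2 G (X i) Y)"
  by (induction I rule: finite_induct)
    (simp_all add: bform2_def algebra_simps sum.distrib)

lemma bform2_sum_right: "finite I \<Longrightarrow> bform2 G X (\<lambda>\<mu> \<nu>. \<Sum>i\<in>I. Y i \<mu> \<nu>) = (\<Sum>i\<in>I. bform2 G X (Y i))"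
  by (induction I rule: finite_induct)
    (simp_all add: bform2_def algebra_simps sum.distrib)

lemma bform2_mult_left: "bform2 G (\<lambda>\<kappa> \<tau>. c * X \<kappa> \<tau>) Y = c * bform2 G X Y"
  by (simp add: bform2_def sum_distrib_left mult_ac)

lemma bform2_mult_right: "bform2 G X (\<lambda>\<mu> \<nu>. c * Y \<mu> \<nu>) = c * bform2 G X Y"
  by (simp add: bform2_def sum_distrib_left mult_ac)

lemma bform2_prod: "bform2 G (\<lambda>\<kappa> \<tau>. x \<kappa> * x' \<tau>) (\<lambda>\<mu> \<nu>. y \<mu> * y' \<nu>) = bform G x y * bform G x' y'"
  unfolding bform2_def bform_def sum_product
  by (intro sum.cong refl) (simp add: mult_ac)

text \<open>For \<open>G\<close> the inverse metric this is \<open>S\<^sub>i\<^sub>k\<close> of the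
  overview, as a matrix product, so that a change of coframe acts by congruence.\<close>

definition sd_contr :: "real tensor2 \<Rightarrow> real^4^4 \<Rightarrow> 3 \<Rightarrow> 3 \<Rightarrow> complex^4^4" where
  "sd_contr G \<Theta> i k = sd_form \<Theta> i ** cmat G ** transpose (cnjmat (sd_form \<Theta> k))"

lemma bform_sd_form: "bform G (\<lambda>\<kappa>. sd_form \<Theta> i $\<alpha>$\<kappa>) (\<lambda>\<rho>. cnj (sd_form \<Theta> k $\<mu>$\<rho>)) = sd_contr G \<Theta> i k $\<alpha>$\<mu>"
  by (simp add: sd_contr_def bform_def matrix_matrix_mult_def transpose_def cmat_def cnjmat_def sum_distrib_right)

lemma sd_form_frame: "sd_form \<Theta> i = transpose (cmat \<Theta>) ** sd_form (mat 1) i ** cmat \<Theta>"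
proof -
  have "sd_form \<Theta> i $\<alpha>$\<beta> = (transpose (cmat \<Theta>) ** sd_form (mat 1) i ** cmat \<Theta>) $\<alpha>$\<beta>" for \<alpha> \<beta>
    using exhaust_3[of i]
    by (elim disjE; simp add: matrix_matrix_mult_def transpose_def sum_UNIV_4 sd_form_def electric_def magnetic_def
      cowedge_def sp_idx_simps mat_def cmat_def)
     (simp_all add: complex_eq_iff algebra_simps)
  then show ?thesis by (simp add: vec_eq_iff)
qed

text \<open>Each form carries \<open>cmat \<Theta>\<close> on both sides, and the inner copies
  together with the inverse metric collapse to \<open>minkowski\<close>. Symmetry and orthogonality
  then need checking only for constant matrices.\<close>

lemma sd_contr_frame:
  assumes "coframe g ori \<Theta>"
  shows "sd_contr (matrix_inv g) \<Theta> i k = transpose (cmat \<Theta>) ** sd_contr minkowski (mat 1) i k ** cmat \<Theta>"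
proof -
  have c: "transpose (cnjmat (sd_form \<Theta> k)) = transpose (cmat \<Theta>) ** transpose (cnjmat (sd_form (mat 1) k)) ** cmat \<Theta>"
  proof -
    have "cnjmat (sd_form \<Theta> k) = transpose (cmat \<Theta>) ** cnjmat (sd_form (mat 1) k) ** cmat \<Theta>"
      by (subst sd_form_frame) (simp add: cnjmat_def cmat_def transpose_def matrix_matrix_mult_def vec_eq_iff)
    then show ?thesis by (simp add: matrix_transpose_mul matrix_mul_assoc)
  qed
  have "sd_contr (matrix_inv g) \<Theta> i k = transpose (cmat \<Theta>) ** sd_form (mat 1) i **
     (cmat \<Theta> ** cmat (matrix_inv g) ** transpose (cmat \<Theta>)) ** transpose (cnjmat (sd_form (mat 1) k)) ** cmat \<Theta>"
    unfolding sd_contr_def c by (subst sd_form_frame) (simp add: matrix_mul_assoc)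
  also have "cmat \<Theta> ** cmat (matrix_inv g) ** transpose (cmat \<Theta>) = cmat minkowski"
    unfolding coframe_inverse_metric(1)[OF assms, symmetric] by (simp add: cmat_mult cmat_transpose)
  finally show ?thesis by (simp add: sd_contr_def matrix_mul_assoc)
qed

lemma bform_coframe:
  assumes "coframe g ori \<Theta>"
  shows "bform (matrix_inv g) (\<lambda>\<alpha>. cmat \<Theta> $a$\<alpha>) (\<lambda>\<alpha>. cmat \<Theta> $b$\<alpha>) = of_real (minkowski$a$b)"
proof -
  have "bform (matrix_inv g) (\<lambda>\<alpha>. cmat \<Theta> $a$\<alpha>) (\<lambda>\<alpha>. cmat \<Theta> $b$\<alpha>) = of_real ((\<Theta> ** matrix_inv g ** transpose \<Theta>)$a$b)"
    by (simp add: bform_def cmat_def matrix_matrix_mult_def transpose_def sum_distrib_right)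
  then show ?thesis unfolding coframe_inverse_metric(1)[OF assms] .
qed

lemma bform2_coframe:
  assumes "coframe g ori \<Theta>"
  shows "bform2 (matrix_inv g) (\<lambda>\<alpha> \<beta>. (transpose (cmat \<Theta>) ** X ** cmat \<Theta>)$\<alpha>$\<beta>)
      (\<lambda>\<alpha> \<beta>. (transpose (cmat \<Theta>) ** Y ** cmat \<Theta>)$\<alpha>$\<beta>) =
    (\<Sum>a\<in>UNIV. \<Sum>b\<in>UNIV. of_real (minkowski$a$a) * of_real (minkowski$b$b) * X$a$b * Y$a$b)"
proof -
  have e: "(transpose (cmat \<Theta>) ** X ** cmat \<Theta>)$\<alpha>$\<beta> =
     (\<Sum>b\<in>UNIV. \<Sum>a\<in>UNIV. X$a$b * (cmat \<Theta> $a$\<alpha> * cmat \<Theta> $b$\<beta>))" for X \<alpha> \<beta>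
    by (simp add: matrix_matrix_mult_def transpose_def sum_distrib_left sum_distrib_right mult_ac)
  show ?thesis
    unfolding e by (simp add: bform2_sum_left bform2_sum_right bform2_mult_left bform2_mult_right bform2_prod
       bform_coframe[OF assms])
     (simp add: sum_UNIV_4 minkowski_def algebra_simps)
qed

lemma sd_contr_minkowski_nth:
  "sd_contr minkowski (mat 1) i k $a$b = (\<Sum>c\<in>UNIV. of_real (minkowski$c$c) * sd_form (mat 1) i $a$c * cnj (sd_form (mat 1) k $b$c))"
  by (simp add: sd_contr_def matrix_matrix_mult_def transpose_def cmat_def cnjmat_def)
    (simp add: minkowski_def sum_UNIV_4)

text \<open>In the index type of spatial directions the numeral 3 equals 0, so the third direction
  appears here as 0.\<close>

lemma sd_form_mat1:
  "sd_form (mat 1) 1 $0$0 = 0"  "sd_form (mat 1) 1 $0$1 = 1"  "sd_form (mat 1) 1 $0$2 = 0"  "sd_form (mat 1) 1 $0$3 = 0"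
  "sd_form (mat 1) 1 $1$0 = -1"  "sd_form (mat 1) 1 $1$1 = 0"  "sd_form (mat 1) 1 $1$2 = 0"  "sd_form (mat 1) 1 $1$3 = 0"
  "sd_form (mat 1) 1 $2$0 = 0"  "sd_form (mat 1) 1 $2$1 = 0"  "sd_form (mat 1) 1 $2$2 = 0"  "sd_form (mat 1) 1 $2$3 = \<i>"
  "sd_form (mat 1) 1 $3$0 = 0"  "sd_form (mat 1) 1 $3$1 = 0"  "sd_form (mat 1) 1 $3$2 = -\<i>"  "sd_form (mat 1) 1 $3$3 = 0"
  "sd_form (mat 1) 2 $0$0 = 0"  "sd_form (mat 1) 2 $0$1 = 0"  "sd_form (mat 1) 2 $0$2 = 1"  "sd_form (mat 1) 2 $0$3 = 0"
  "sd_form (mat 1) 2 $1$0 = 0"  "sd_form (mat 1) 2 $1$1 = 0"  "sd_form (mat 1) 2 $1$2 = 0"  "sd_form (mat 1) 2 $1$3 = -\<i>"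
  "sd_form (mat 1) 2 $2$0 = -1"  "sd_form (mat 1) 2 $2$1 = 0"  "sd_form (mat 1) 2 $2$2 = 0"  "sd_form (mat 1) 2 $2$3 = 0"
  "sd_form (mat 1) 2 $3$0 = 0"  "sd_form (mat 1) 2 $3$1 = \<i>"  "sd_form (mat 1) 2 $3$2 = 0"  "sd_form (mat 1) 2 $3$3 = 0"
  "sd_form (mat 1) 0 $0$0 = 0"  "sd_form (mat 1) 0 $0$1 = 0"  "sd_form (mat 1) 0 $0$2 = 0"  "sd_form (mat 1) 0 $0$3 = 1"
  "sd_form (mat 1) 0 $1$0 = 0"  "sd_form (mat 1) 0 $1$1 = 0"  "sd_form (mat 1) 0 $1$2 = \<i>"  "sd_form (mat 1) 0 $1$3 = 0"
  "sd_form (mat 1) 0 $2$0 = 0"  "sd_form (mat 1) 0 $2$1 = -\<i>"  "sd_form (mat 1) 0 $2$2 = 0"  "sd_form (mat 1) 0 $2$3 = 0"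
  "sd_form (mat 1) 0 $3$0 = -1"  "sd_form (mat 1) 0 $3$1 = 0"  "sd_form (mat 1) 0 $3$2 = 0"  "sd_form (mat 1) 0 $3$3 = 0"
  by (simp_all add: sd_form_def electric_def magnetic_def cowedge_def sp_idx_simps mat_def complex_eq_iff)

lemma forall_UNIV_3: "(\<forall>i::3. P i) \<longleftrightarrow> P 1 \<and> P 2 \<and> P 0"
proof -
  have "(3::3) = 0" by simp
  then show ?thesis using forall_3[of P] by metis
qed

lemma sd_contr_minkowski_sym: "sd_contr minkowski (mat 1) i k $a$b = sd_contr minkowski (mat 1) i k $b$a"
proof -
  have "\<forall>i k a b. sd_contr minkowski (mat 1) i k $a$b = sd_contr minkowski (mat 1) i k $b$a"
    unfolding sd_contr_minkowski_nth forall_UNIV_3 forall_UNIV_4 sum_UNIV_4 by (simp add: sd_form_mat1 minkowski_def)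
  then show ?thesis by blast
qed

text \<open>A finite check in the constant frame. The value 4 is the common square of the nine
  tensors and the source of the factors 4 in the composition rules.\<close>

lemma sd_contr_minkowski_orth: "(\<Sum>a\<in>UNIV. \<Sum>b\<in>UNIV. of_real (minkowski$a$a) * of_real (minkowski$b$b)
   * sd_contr minkowski (mat 1) i k $a$b * sd_contr minkowski (mat 1) j l $a$b) = (if i = j \<and> k = l then 4 else 0)"
proof -
  define s where "s i k a b = sd_contr minkowski (mat 1) i k $a$b" for i k a b
  have s: "\<forall>i k a b. s i k a b = sd_contr minkowski (mat 1) i k $a$b" by (simp add: s_def)
  note s' = s[unfolded sd_contr_minkowski_nth forall_UNIV_3 forall_UNIV_4 sum_UNIV_4, simplified sd_form_mat1 minkowski_def, simplified]
  have "\<forall>i k j l. (\<Sum>a\<in>UNIV. \<Sum>b\<in>UNIV. of_real (minkowski$a$a) * of_real (minkowski$b$b)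
   * s i k a b * s j l a b) = (if i = j \<and> k = l then 4 else 0)"
    unfolding forall_UNIV_3 sum_UNIV_4 by (simp add: s' minkowski_def)
  then show ?thesis unfolding s_def by blast
qed

lemma sum_UNIV_prod: "(\<Sum>J\<in>(UNIV::('a::finite \<times> 'b::finite) set). f J) = (\<Sum>j\<in>UNIV. \<Sum>l\<in>UNIV. f (j,l))"
  by (simp add: sum.cartesian_product)

lemma transpose_eq_nth:
  assumes "transpose M = M"
  shows "M$a$b = M$b$a"
proof -
  have "transpose M $b$a = M$b$a" unfolding assms ..
  then show ?thesis by (simp add: transpose_def)
qed

lemma cnj_sd_contr_nth: "cnj (sd_contr G \<Theta> i k $\<alpha>$\<mu>) = (\<Sum>\<rho>\<in>UNIV. \<Sum>\<kappa>\<in>UNIV. sd_form \<Theta> k $\<mu>$\<rho> * of_real (G$\<kappa>$\<rho>) * cnj (sd_form \<Theta> i $\<alpha>$\<kappa>))"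
  by (simp add: bform_sd_form[symmetric] bform_def mult_ac)

section \<open>Composition and faithfulness of the Kronecker construction\<close>

context
  fixes g ori \<Theta> assumes cf: "coframe g ori \<Theta>"
begin

abbreviation sd_contr_pair :: "3 \<times> 3 \<Rightarrow> complex^4^4" where
  "sd_contr_pair I \<equiv> sd_contr (matrix_inv g) \<Theta> (fst I) (snd I)"

lemma sd_contr_sym: "sd_contr (matrix_inv g) \<Theta> i k $\<alpha>$\<mu> = sd_contr (matrix_inv g) \<Theta> i k $\<mu>$\<alpha>"
proof -
  have "transpose (sd_contr minkowski (mat 1) i k) = sd_contr minkowski (mat 1) i k"
    using sd_contr_minkowski_sym by (simp add: vec_eq_iff transpose_def)
  then have "transpose (sd_contr (matrix_inv g) \<Theta> i k) = sd_contr (matrix_inv g) \<Theta> i k"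
    by (simp add: sd_contr_frame[OF cf] matrix_transpose_mul matrix_mul_assoc)
  then show ?thesis by (rule transpose_eq_nth)
qed

lemma matrix_inv_sym: "matrix_inv g $\<alpha>$\<beta> = matrix_inv g $\<beta>$\<alpha>"
proof -
  have "transpose (matrix_inv g) = matrix_inv g"
    by (simp add: coframe_matrix_inv[OF cf] matrix_transpose_mul matrix_mul_assoc transpose_minkowski)
  then show ?thesis by (rule transpose_eq_nth)
qed

text \<open>Conjugation exchanges the two forms and with them the two tensor indices; symmetry
  restores the order of the indices.\<close>

lemma cnj_sd_contr: "cnj (sd_contr (matrix_inv g) \<Theta> i k $\<alpha>$\<mu>) = sd_contr (matrix_inv g) \<Theta> k i $\<alpha>$\<mu>"
proof -
  have "cnj (sd_contr (matrix_inv g) \<Theta> i k $\<alpha>$\<mu>) = sd_contr (matrix_inv g) \<Theta> k i $\<mu>$\<alpha>"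
    unfolding cnj_sd_contr_nth unfolding bform_sd_form[symmetric] bform_def
    by (subst sum.swap, intro sum.cong refl) (simp add: matrix_inv_sym)
  then show ?thesis by (simp only: sd_contr_sym)
qed

lemma sd_contr_pair_orth: "bform2 (matrix_inv g) (\<lambda>\<kappa> \<tau>. sd_contr_pair I $\<kappa>$\<tau>) (\<lambda>\<kappa> \<tau>. sd_contr_pair J $\<kappa>$\<tau>) = (if I = J then 4 else 0)"
  unfolding sd_contr_frame[OF cf] bform2_coframe[OF cf] sd_contr_minkowski_orth by (simp add: prod_eq_iff)

definition kron :: "complex^3^3 \<Rightarrow> 3 \<times> 3 \<Rightarrow> 3 \<times> 3 \<Rightarrow> complex" where
  "kron B I J = B$fst I$fst J * cnj (B$snd I$snd J)"

lemma kron_mult: "(\<Sum>J\<in>UNIV. kron A I J * kron B J N) = kron (A ** B) I N"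
proof -
  show ?thesis by (simp add: sum_UNIV_prod kron_def matrix_matrix_mult_def sum_product mult_ac)
qed

definition kron_tensor :: "complex^3^3 \<Rightarrow> 4 \<Rightarrow> 4 \<Rightarrow> 4 \<Rightarrow> 4 \<Rightarrow> complex" where
  "kron_tensor B \<alpha> \<mu> \<beta> \<nu> = (\<Sum>I\<in>UNIV. \<Sum>J\<in>UNIV. kron B I J * sd_contr_pair I $\<alpha>$\<mu> * sd_contr_pair J $\<beta>$\<nu>)"

text \<open>Conjugation swaps the two components of \<open>I\<close> and of \<open>J\<close>, which
  merely permutes the terms of the double sum. This is why the Bel-Robinson tensor is real.\<close>

lemma cnj_kron_tensor: "cnj (kron_tensor B \<alpha> \<mu> \<beta> \<nu>) = kron_tensor B \<alpha> \<mu> \<beta> \<nu>"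
proof -
  have "cnj (kron_tensor B \<alpha> \<mu> \<beta> \<nu>) = (\<Sum>I\<in>UNIV. \<Sum>J\<in>UNIV. kron B (prod.swap I) (prod.swap J) * sd_contr_pair (prod.swap I) $\<alpha>$\<mu> * sd_contr_pair (prod.swap J) $\<beta>$\<nu>)"
    by (simp add: kron_tensor_def kron_def cnj_sd_contr mult_ac)
  also have "\<dots> = (\<Sum>I\<in>UNIV. \<Sum>J\<in>UNIV. kron B (prod.swap I) J * sd_contr_pair (prod.swap I) $\<alpha>$\<mu> * sd_contr_pair J $\<beta>$\<nu>)"
    by (intro sum.cong refl sum.reindex_bij_betw[OF bij_swap])
  also have "\<dots> = kron_tensor B \<alpha> \<mu> \<beta> \<nu>"
    unfolding kron_tensor_def by (rule sum.reindex_bij_betw[OF bij_swap, of "\<lambda>I. \<Sum>J\<in>UNIV. kron B I J * sd_contr_pair I $\<alpha>$\<mu> * sd_contr_pair J $\<beta>$\<nu>"])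
  finally show ?thesis .
qed

text \<open>Orthogonality identifies the two inner index pairs at the cost of the norm 4, and what
  remains is a matrix product of Kronecker matrices.\<close>

lemma kron_tensor_comp: "bform2 (matrix_inv g) (\<lambda>\<kappa> \<tau>. kron_tensor A \<alpha> \<beta> \<kappa> \<tau>) (\<lambda>\<mu> \<nu>. kron_tensor B \<mu> \<nu> \<rho> \<sigma>) = 4 * kron_tensor (A ** B) \<alpha> \<beta> \<rho> \<sigma>"
proof -
  have 1: "kron_tensor A \<alpha> \<beta> \<kappa> \<tau> = (\<Sum>I\<in>UNIV. \<Sum>J\<in>UNIV. (kron A I J * sd_contr_pair I $\<alpha>$\<beta>) * sd_contr_pair J $\<kappa>$\<tau>)" for \<kappa> \<tau>
    by (simp add: kron_tensor_def)
  have 2: "kron_tensor B \<mu> \<nu> \<rho> \<sigma> = (\<Sum>N\<in>UNIV. \<Sum>M\<in>UNIV. (kron B M N * sd_contr_pair N $\<rho>$\<sigma>) * sd_contr_pair M $\<mu>$\<nu>)" for \<mu> \<nu>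
    unfolding kron_tensor_def by (subst sum.swap) (simp add: mult_ac)
  have "bform2 (matrix_inv g) (\<lambda>\<kappa> \<tau>. kron_tensor A \<alpha> \<beta> \<kappa> \<tau>) (\<lambda>\<mu> \<nu>. kron_tensor B \<mu> \<nu> \<rho> \<sigma>)
     = (\<Sum>I\<in>UNIV. \<Sum>J\<in>UNIV. \<Sum>N\<in>UNIV. kron A I J * sd_contr_pair I $\<alpha>$\<beta> * (kron B J N * sd_contr_pair N $\<rho>$\<sigma> * 4))"
    unfolding 1 2
    by (simp add: bform2_sum_left bform2_sum_right bform2_mult_left bform2_mult_right sd_contr_pair_orth
       if_distrib[of "\<lambda>x. _ * x"] cong: if_cong) (simp only: sum_distrib_left)
  also have "\<dots> = (\<Sum>I\<in>UNIV. \<Sum>N\<in>UNIV. \<Sum>J\<in>UNIV. kron A I J * sd_contr_pair I $\<alpha>$\<beta> * (kron B J N * sd_contr_pair N $\<rho>$\<sigma> * 4))"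
    by (intro sum.cong refl sum.swap)
  also have "\<dots> = 4 * kron_tensor (A ** B) \<alpha> \<beta> \<rho> \<sigma>"
    unfolding kron_tensor_def kron_mult[symmetric]
    by (simp add: sum_distrib_left sum_distrib_right mult_ac)
  finally show ?thesis .
qed

text \<open>Pairing with the orthogonal tensors on both sides isolates each Kronecker entry, and the
  entry at \<open>(i,i)\<close>, \<open>(j,j)\<close> is the squared modulus of
  \<open>B$i$j\<close>.\<close>

lemma kron_tensor_eq_0D:
  assumes "\<And>\<alpha> \<mu> \<beta> \<nu>. kron_tensor B \<alpha> \<mu> \<beta> \<nu> = 0"
  shows "B = 0"
proof -
  have 0: "bform2 G X (\<lambda>\<mu> \<nu>. 0) = 0" for G X by (simp add: bform2_def)
  have "(\<Sum>J\<in>UNIV. kron B I J * sd_contr_pair J $\<beta>$\<nu>) = 0" for I \<beta> \<nu>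
  proof -
    have e: "kron_tensor B \<alpha> \<mu> \<beta> \<nu> = (\<Sum>I\<in>UNIV. (\<Sum>J\<in>UNIV. kron B I J * sd_contr_pair J $\<beta>$\<nu>) * sd_contr_pair I $\<alpha>$\<mu>)" for \<alpha> \<mu>
      by (simp add: kron_tensor_def sum_distrib_left sum_distrib_right mult_ac)
    have "bform2 (matrix_inv g) (\<lambda>\<alpha> \<mu>. sd_contr_pair I $\<alpha>$\<mu>) (\<lambda>\<alpha> \<mu>. kron_tensor B \<alpha> \<mu> \<beta> \<nu>) = 0"
      unfolding assms by (rule 0)
    then show ?thesis
      unfolding e by (simp add: bform2_sum_right bform2_mult_right sd_contr_pair_orth
       if_distrib[of "\<lambda>x. _ * x"] cong: if_cong)
  qed
  note 1 = this
  have K: "kron B I J = 0" for I J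
  proof -
    have "bform2 (matrix_inv g) (\<lambda>\<alpha> \<mu>. sd_contr_pair J $\<alpha>$\<mu>) (\<lambda>\<beta> \<nu>. (\<Sum>J\<in>UNIV. kron B I J * sd_contr_pair J $\<beta>$\<nu>)) = 0"
      unfolding 1 by (rule 0)
    then show ?thesis
      by (simp add: bform2_sum_right bform2_mult_right sd_contr_pair_orth if_distrib[of "\<lambda>x. _ * x"] cong: if_cong)
  qed
  have "B$i$j = 0" for i j
    using K[of "(i,i)" "(j,j)"] by (simp add: kron_def)
  then show ?thesis by (simp add: vec_eq_iff)
qed

text \<open>The free indices \<alpha>, \<mu> couple a form from the first index pair with a
  conjugate one, and \<beta>, \<nu> do so for the second pair. Hence the four summation indices
  regroup as (i,k) and (j,l).\<close>

lemma bel_robinson_eq_kron_tensor: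
  assumes V: "\<And>\<alpha> \<beta> \<mu> \<nu>. self_dual_weyl g ori W $\<alpha>$\<beta>$\<mu>$\<nu> =
      (\<Sum>i\<in>UNIV. \<Sum>j\<in>UNIV. A$i$j * sd_form \<Theta> i $\<alpha>$\<beta> * sd_form \<Theta> j $\<mu>$\<nu>)"
  shows "complex_of_real (bel_robinson g ori W $\<alpha>$\<mu>$\<beta>$\<nu>) = kron_tensor A \<alpha> \<mu> \<beta> \<nu>"
proof -
  let ?V = "self_dual_weyl g ori W"
  have "bform2 (matrix_inv g) (\<lambda>\<kappa> \<tau>. ?V$\<alpha>$\<kappa>$\<beta>$\<tau>) (\<lambda>\<rho> \<sigma>. cnj (?V$\<mu>$\<rho>$\<nu>$\<sigma>)) =
     (\<Sum>i\<in>UNIV. \<Sum>j\<in>UNIV. \<Sum>k\<in>UNIV. \<Sum>l\<in>UNIV. (A$i$j * cnj (A$k$l)) * (sd_contr_pair (i,k) $\<alpha>$\<mu> * sd_contr_pair (j,l) $\<beta>$\<nu>))"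
    unfolding V
    by (simp add: bform2_sum_left bform2_sum_right bform2_mult_left bform2_mult_right bform2_prod bform_sd_form mult.assoc)
     (simp only: sum_distrib_left)
  also have "\<dots> = (\<Sum>i\<in>UNIV. \<Sum>k\<in>UNIV. \<Sum>j\<in>UNIV. \<Sum>l\<in>UNIV. (A$i$j * cnj (A$k$l)) * (sd_contr_pair (i,k) $\<alpha>$\<mu> * sd_contr_pair (j,l) $\<beta>$\<nu>))"
    by (intro sum.cong refl sum.swap)
  also have "\<dots> = kron_tensor A \<alpha> \<mu> \<beta> \<nu>"
    by (simp add: kron_tensor_def sum_UNIV_prod kron_def mult_ac)
  finally have e: "bform2 (matrix_inv g) (\<lambda>\<kappa> \<tau>. ?V$\<alpha>$\<kappa>$\<beta>$\<tau>) (\<lambda>\<rho> \<sigma>. cnj (?V$\<mu>$\<rho>$\<nu>$\<sigma>)) = kron_tensor A \<alpha> \<mu> \<beta> \<nu>" .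
  have "bel_robinson g ori W $\<alpha>$\<mu>$\<beta>$\<nu> = Re (kron_tensor A \<alpha> \<mu> \<beta> \<nu>)"
    unfolding e[symmetric] bel_robinson_def Let_def bform2_def by simp
  moreover have "kron_tensor A \<alpha> \<mu> \<beta> \<nu> \<in> \<real>" using cnj_kron_tensor by (simp add: Reals_cnj_iff)
  ultimately show ?thesis by simp
qed

lemma tensor_comp_kron_tensor:
  assumes "\<And>\<alpha> \<beta> \<rho> \<sigma>. complex_of_real (S$\<alpha>$\<beta>$\<rho>$\<sigma>) = c * kron_tensor A \<alpha> \<beta> \<rho> \<sigma>"
    and "\<And>\<alpha> \<beta> \<rho> \<sigma>. complex_of_real (T$\<alpha>$\<beta>$\<rho>$\<sigma>) = d * kron_tensor B \<alpha> \<beta> \<rho> \<sigma>"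
  shows "complex_of_real (tensor_comp g S T $\<alpha>$\<beta>$\<rho>$\<sigma>) = 4 * c * d * kron_tensor (A ** B) \<alpha> \<beta> \<rho> \<sigma>"
proof -
  have "complex_of_real (tensor_comp g S T $\<alpha>$\<beta>$\<rho>$\<sigma>) =
    bform2 (matrix_inv g) (\<lambda>\<kappa> \<tau>. complex_of_real (S$\<alpha>$\<beta>$\<kappa>$\<tau>)) (\<lambda>\<mu> \<nu>. complex_of_real (T$\<mu>$\<nu>$\<rho>$\<sigma>))"
    by (simp add: tensor_comp_def bform2_def)
  then show ?thesis unfolding assms by (simp add: bform2_mult_left bform2_mult_right kron_tensor_comp)
qed

lemma bel_robinson_nilpotent:
  assumes V: "\<And>\<alpha> \<beta> \<mu> \<nu>. self_dual_weyl g ori W $\<alpha>$\<beta>$\<mu>$\<nu> =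
      (\<Sum>i\<in>UNIV. \<Sum>j\<in>UNIV. A$i$j * sd_form \<Theta> i $\<alpha>$\<beta> * sd_form \<Theta> j $\<mu>$\<nu>)"
    and T: "T = bel_robinson g ori W" and T2: "T2 = tensor_comp g T T"
    and T3: "tensor_comp g T2 T = 0" and nz: "T2 \<noteq> 0"
  shows "A ** A ** A = 0" "A ** A \<noteq> 0"
proof -
  have t: "complex_of_real (T$\<alpha>$\<beta>$\<rho>$\<sigma>) = 1 * kron_tensor A \<alpha> \<beta> \<rho> \<sigma>" for \<alpha> \<beta> \<rho> \<sigma>
    unfolding T bel_robinson_eq_kron_tensor[OF V] by simp
  note t2 = tensor_comp_kron_tensor[OF t t, folded T2]
  note t3 = tensor_comp_kron_tensor[OF t2 t, unfolded T3]
  show "A ** A ** A = 0" using t3 by (intro kron_tensor_eq_0D) simp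
  show "A ** A \<noteq> 0"
  proof
    assume "A ** A = 0"
    then have "T2$\<alpha>$\<beta>$\<rho>$\<sigma> = 0" for \<alpha> \<beta> \<rho> \<sigma>
      using t2[of \<alpha> \<beta> \<rho> \<sigma>] by (simp add: kron_tensor_def kron_def)
    then show False using nz by (simp add: vec_eq_iff)
  qed
qed

end

section \<open>Normal form of nilpotent symmetric matrices\<close>

text \<open>There is no conjugation: symmetric complex matrices are self-adjoint for this form, and
  non-zero vectors may be null.\<close>

definition cdot :: "complex^3 \<Rightarrow> complex^3 \<Rightarrow> complex" where
  "cdot x y = (\<Sum>i\<in>UNIV. x$i * y$i)"

lemma cdot_commute: "cdot x y = cdot y x"
  by (simp add: cdot_def mult.commute)

lemma cdot_add: "cdot (x + y) z = cdot x z + cdot y z" "cdot z (x + y) = cdot z x + cdot z y"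
  and cdot_scale: "cdot (c *s x) z = c * cdot x z" "cdot z (c *s x) = c * cdot z x"
  by (simp_all add: cdot_def sum.distrib sum_distrib_left algebra_simps)

lemma cdot_symmetric_matrix:
  assumes "transpose A = A"
  shows "cdot (A *v x) y = cdot x (A *v y)"
proof -
  have "cdot (A *v x) y = (\<Sum>i\<in>UNIV. \<Sum>j\<in>UNIV. x$i * (transpose A $i$j * y$j))"
    unfolding cdot_def matrix_vector_mult_def
    by (simp add: sum_distrib_left sum_distrib_right transpose_def) (subst sum.swap, simp add: mult_ac)
  then show ?thesis unfolding assms by (simp add: cdot_def matrix_vector_mult_def sum_distrib_left)
qed

lemma matrix_vector_mult_axis_nth: "(A *v axis j 1)$i = (A$i$j :: 'a::comm_ring_1)"
  by (simp add: matrix_vector_mult_def axis_def if_distrib[of "\<lambda>x. _ * x"] cong: if_cong)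

lemma cdot_axis: "cdot x (axis j 1) = x$j"
  by (simp add: cdot_def axis_def if_distrib[of "\<lambda>x. _ * x"] cong: if_cong)

text \<open>Polarisation: if the quadratic form vanished on all axis vectors and on their pairwise
  sums, every entry of \<open>B\<close> would be zero.\<close>

lemma symmetric_quadratic_form_nonzero:
  fixes B :: "complex^3^3"
  assumes "transpose B = B" "B \<noteq> 0"
  obtains z where "cdot z (B *v z) \<noteq> 0"
proof -
  have "\<exists>z. cdot z (B *v z) \<noteq> 0"
  proof (rule ccontr)
    assume "\<not> ?thesis"
    then have 0: "cdot z (B *v z) = 0" for z by auto
    have ax: "cdot (axis i 1) (B *v axis j 1) = B$i$j" for i j
      by (simp add: cdot_def matrix_vector_mult_axis_nth) (simp add: axis_def if_distrib[of "\<lambda>x. x * _"] cong: if_cong)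
    have "B$i$j = 0" for i j
    proof -
      have "B$i$j = B$j$i" by (rule transpose_eq_nth[OF assms(1)])
      then show ?thesis
        using 0[of "axis i 1 + axis j 1"] 0[of "axis i 1"] 0[of "axis j 1"]
        by (simp add: matrix_vector_right_distrib cdot_add ax)
    qed
    then show False using assms(2) by (simp add: vec_eq_iff)
  qed
  then show ?thesis using that by blast
qed

text \<open>With \<open>z\<close> such that \<open>z \<cdot> A\<^sup>2 z = 1\<close> and \<open>z \<cdot> A z = 0\<close>, take \<open>U = A z\<close> and \<open>L = A\<^sup>2 z\<close>.\<close>

lemma symmetric_nilpotent_normal_form:
  fixes A :: "complex^3^3"
  assumes sym: "transpose A = A" and A3: "A ** A ** A = 0" and A2: "A ** A \<noteq> 0"
  obtains U L where "\<And>i j. A$i$j = U$i * L$j + L$i * U$j" "cdot U U = 1" "cdot U L = 0" "cdot L L = 0" "L \<noteq> 0"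
proof -
  have sA: "cdot (A *v x) y = cdot x (A *v y)" for x y by (rule cdot_symmetric_matrix[OF sym])
  have A30: "A *v (A *v (A *v x)) = 0" for x
    by (simp add: matrix_vector_mul_assoc matrix_mul_assoc A3)
  have "transpose (A ** A) = A ** A" by (simp add: matrix_transpose_mul sym)
  then obtain z0 where z0: "cdot z0 (A *v (A *v z0)) \<noteq> 0"
    using symmetric_quadratic_form_nonzero[OF _ A2] by (metis matrix_vector_mul_assoc)
  define d where "d = cdot z0 (A *v (A *v z0))"
  define z1 where "z1 = (1 / csqrt d) *s z0"
  have Asc: "A *v (c *s x) = c *s (A *v x)" for c x by (rule vector_scalar_commute)
  have "csqrt d * csqrt d = d" by (metis power2_csqrt power2_eq_square)
  then have z1: "cdot z1 (A *v (A *v z1)) = 1"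
    using z0 by (simp add: z1_def Asc cdot_scale d_def[symmetric] field_simps)
  define c where "c = cdot z1 (A *v z1)"
  \<comment> \<open>Adding k A z1 to z1 changes z \<cdot> A z by 2k because z1 \<cdot> A^2 z1 = 1.
    As A^3 = 0, it leaves A^2 z and z \<cdot> A^2 z unchanged.\<close>
  define k where "k = - c / 2"
  have k: "c + 2 * k = 0" by (simp add: k_def)
  define z where "z = z1 + k *s (A *v z1)"
  define U where "U = A *v z"
  define L where "L = A *v U"
  have cd0: "cdot x 0 = 0" for x by (simp add: cdot_def)
  have AL: "A *v L = 0" by (simp add: L_def U_def A30)
  have Az: "A *v z = A *v z1 + k *s (A *v (A *v z1))" "A *v (A *v z) = A *v (A *v z1)"
    by (simp_all add: z_def matrix_vector_right_distrib Asc A30)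
  have zL: "cdot z L = 1"
    by (simp add: L_def U_def Az(2)) (simp add: z_def cdot_add cdot_scale z1 sA A30 cd0)
  have zU: "cdot z U = 0"
  proof -
    have "cdot z U = c + 2 * k"
      by (simp add: U_def Az(1)) (simp add: z_def cdot_add cdot_scale z1 sA A30 cd0 c_def[symmetric])
    then show ?thesis using k by simp
  qed
  have UU: "cdot U U = 1" using zL by (simp add: U_def L_def sA)
  have UL: "cdot U L = 0" by (simp add: U_def sA AL cd0)
  have LL: "cdot L L = 0" by (simp add: L_def[of ] sA) (simp add: L_def[symmetric] AL cd0)
  have Lne: "L \<noteq> 0" using zL by (auto simp: cd0)
  define M :: "complex^3^3" where "M = (\<chi> i j. if j = 1 then z$i else if j = 2 then U$i else L$i)"
  \<comment> \<open>\<open>y\<close> is z corrected by a multiple of L so as to be orthogonal to z.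
    This makes the rows L, U, y of \<open>N\<close> dual to the columns z, U, L of
    \<open>M\<close>.\<close>
  define q where "q = - cdot z z"
  have q: "cdot z z + q = 0" by (simp add: q_def)
  define y where "y = z + q *s L"
  define N :: "complex^3^3" where "N = (\<chi> i. if i = 1 then L else if i = 2 then U else y)"
  have NM: "(N ** M)$i$j = cdot (N$i) (if j = 1 then z else if j = 2 then U else L)" for i j
    by (simp add: matrix_matrix_mult_def cdot_def M_def)
  have "N ** M = mat 1"
    unfolding vec_eq_iff forall_UNIV_3 NM
    by (simp add: q N_def y_def mat_def cdot_add cdot_scale zL zU UU UL LL cdot_commute[of L U] cdot_commute[of U z] cdot_commute[of L z])
  then have MN: "M ** N = mat 1" by (simp add: matrix_left_right_inverse)
  have comp: "v = cdot L v *s z + cdot U v *s U + cdot y v *s L" for v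
  proof -
    have "M *v (N *v v) = cdot L v *s z + cdot U v *s U + cdot y v *s L"
      by (simp add: vec_eq_iff matrix_vector_mult_def M_def N_def sum_3 cdot_def algebra_simps)
    then show ?thesis by (simp add: matrix_vector_mul_assoc MN)
  qed
  \<comment> \<open>On this basis A acts by z \<mapsto> U \<mapsto> L \<mapsto> 0, so only the
    coefficients of z and U matter.\<close>
  have Av: "A *v v = cdot L v *s U + cdot U v *s L" for v
    by (subst comp) (simp add: matrix_vector_right_distrib Asc AL U_def[symmetric] L_def[symmetric])
  have "A$i$j = U$i * L$j + L$i * U$j" for i j
    using arg_cong[OF Av[of "axis j 1"], of "\<lambda>v. v$i"]
    by (simp add: matrix_vector_mult_axis_nth cdot_axis mult.commute)
  then show ?thesis using that UU UL LL Lne by blast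
qed

text \<open>The real and imaginary parts of L \<cdot> L = 0 say that Re L and Im L have equal length
  and are orthogonal; \<open>\<rho>\<close> is that common length.\<close>

lemma null_complex_vector:
  fixes L :: "complex^3"
  assumes "cdot L L = 0" "L \<noteq> 0"
  obtains \<rho> :: real and r1 r2 :: "real^3" where "\<rho> \<noteq> 0" "r1 \<bullet> r1 = 1" "r2 \<bullet> r2 = 1" "r1 \<bullet> r2 = 0"
    "\<And>i. L$i = \<rho> * Complex (r1$i) (r2$i)"
proof -
  define E B :: "real^3" where "E = (\<chi> i. Re (L$i))" and "B = (\<chi> i. Im (L$i))"
  have 1: "E \<bullet> E = B \<bullet> B" "E \<bullet> B = 0"
    using arg_cong[OF assms(1), of Re] arg_cong[OF assms(1), of Im]
    by (simp_all add: cdot_def E_def B_def inner_vec_def sum_subtractf sum.distrib[symmetric] mult.commute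
        sum_distrib_left[symmetric] flip: mult_2)
  have "E \<noteq> 0"
  proof
    assume "E = 0"
    then have "B = 0" using 1 by simp
    with \<open>E = 0\<close> have "L$i = 0" for i by (simp add: E_def B_def vec_eq_iff complex_eq_iff)
    then show False using assms(2) by (simp add: vec_eq_iff)
  qed
  define \<rho> where "\<rho> = norm E"
  have \<rho>: "\<rho> \<noteq> 0" "\<rho> * \<rho> = E \<bullet> E" using \<open>E \<noteq> 0\<close> by (simp_all add: \<rho>_def norm_eq_sqrt_inner)
  show ?thesis
  proof (rule that[of \<rho> "(1/\<rho>) *\<^sub>R E" "(1/\<rho>) *\<^sub>R B"])
    show "L$i = \<rho> * Complex (((1/\<rho>) *\<^sub>R E)$i) (((1/\<rho>) *\<^sub>R B)$i)" for i
      using \<rho>(1) by (simp add: E_def B_def complex_eq_iff)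
  qed (use \<rho> 1 in \<open>auto simp: field_simps\<close>)
qed

text \<open>The completeness relation at the end holds because a square matrix with orthonormal rows
  has orthonormal columns.\<close>

lemma orthonormal_cross:
  fixes r1 r2 :: "real^3"
  assumes "r1 \<bullet> r1 = 1" "r2 \<bullet> r2 = 1" "r1 \<bullet> r2 = 0"
  defines "r3 \<equiv> cross3 r1 r2"
  shows "cross3 r2 r3 = r1" "cross3 r3 r1 = r2" "r3 \<bullet> r3 = 1" "r1 \<bullet> r3 = 0" "r2 \<bullet> r3 = 0"
    "r1$a * r1$b + r2$a * r2$b + r3$a * r3$b = (if a = b then 1 else 0)"
proof -
  show "cross3 r2 r3 = r1"
    unfolding r3_def Lagrange using assms by (simp add: inner_commute)
  have "cross3 r3 r1 = - cross3 r1 r3" by (rule cross_skew)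
  then show "cross3 r3 r1 = r2"
    unfolding r3_def Lagrange using assms by simp
  show 3: "r3 \<bullet> r3 = 1"
    using norm_cross_dot[of r1 r2] assms(1-3) by (simp add: r3_def power2_norm_eq_inner norm_eq_sqrt_inner)
  show 13: "r1 \<bullet> r3 = 0" and 23: "r2 \<bullet> r3 = 0"
    by (simp_all add: r3_def dot_cross_self)
  define R :: "real^3^3" where "R = (\<chi> i. if i = 1 then r1 else if i = 2 then r2 else r3)"
  have RR: "(R ** transpose R)$i$j = R$i \<bullet> R$j" for i j
    by (simp add: matrix_matrix_mult_def transpose_def inner_vec_def)
  have "R ** transpose R = mat 1"
    unfolding vec_eq_iff forall_UNIV_3 RR by (simp add: R_def mat_def assms(1-3) 3 13 23 inner_commute[of r2 r1] inner_commute[of r3 r1] inner_commute[of r3 r2])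
  then have "transpose R ** R = mat 1" by (simp add: matrix_left_right_inverse)
  then have "(transpose R ** R)$a$b = mat 1 $a$b" by simp
  then show "r1$a * r1$b + r2$a * r2$b + r3$a * r3$b = (if a = b then 1 else 0)"
    by (simp add: matrix_matrix_mult_def transpose_def R_def sum_3 mat_def)
qed

text \<open>Expand U in the orthonormal triple. U \<cdot> L = 0 combines the r1 and r2 parts into a
  multiple of r1 + \<i> r2, and U \<cdot> U = 1 then leaves a sign in front of r3. The sign is moved
  into \<open>c\<close>, since r3 is already fixed as a cross product.\<close>

lemma symmetric_nilpotent_rotation_form:
  fixes A :: "complex^3^3"
  assumes sym: "transpose A = A" and A3: "A ** A ** A = 0" and A2: "A ** A \<noteq> 0"
  obtains r1 r2 r3 :: "real^3" and c \<mu> :: complex where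
    "r1 \<bullet> r1 = 1" "r2 \<bullet> r2 = 1" "r1 \<bullet> r2 = 0" "r3 = cross3 r1 r2" "c \<noteq> 0"
    "\<And>i j. A$i$j = c * ((r3$i + \<mu> * Complex (r1$i) (r2$i)) * Complex (r1$j) (r2$j)
       + Complex (r1$i) (r2$i) * (r3$j + \<mu> * Complex (r1$j) (r2$j)))"
proof -
  obtain U L where A: "\<And>i j. A$i$j = U$i * L$j + L$i * U$j" and UU: "cdot U U = 1" and UL: "cdot U L = 0"
    and LL: "cdot L L = 0" and L0: "L \<noteq> 0"
    using symmetric_nilpotent_normal_form[OF assms] by blast
  obtain \<rho> :: real and r1 r2 :: "real^3" where r: "\<rho> \<noteq> 0" "r1 \<bullet> r1 = 1" "r2 \<bullet> r2 = 1" "r1 \<bullet> r2 = 0"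
    and L: "\<And>i. L$i = \<rho> * Complex (r1$i) (r2$i)"
    using null_complex_vector[OF LL L0] by blast
  define r3 where "r3 = cross3 r1 r2"
  note on = orthonormal_cross[OF r(2-4), folded r3_def]
  define a where "a x = (\<Sum>j\<in>UNIV. of_real (x$j) * U$j)" for x :: "real^3"
  have U: "U$i = a r1 * r1$i + a r2 * r2$i + a r3 * r3$i" for i
  proof -
    have "a r1 * r1$i + a r2 * r2$i + a r3 * r3$i = (\<Sum>j\<in>UNIV. of_real (r1$j * r1$i + r2$j * r2$i + r3$j * r3$i) * U$j)"
      by (simp add: a_def sum_distrib_left sum_distrib_right sum.distrib algebra_simps)
    also have "\<dots> = U$i" unfolding on(6) by (simp add: if_distrib[of "\<lambda>x. x * _"] if_distrib[of complex_of_real] cong: if_cong)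
    finally show ?thesis by simp
  qed
  have "\<rho> * (a r1 + \<i> * a r2) = cdot U L"
    by (simp add: cdot_def L a_def sum_distrib_left sum.distrib[symmetric] Complex_eq algebra_simps)
  then have a12: "a r2 = \<i> * a r1"
    using r(1) UL by (simp add: complex_eq_iff)
  have "cdot U U = a r1 * a r1 + a r2 * a r2 + a r3 * a r3"
  proof -
    have "cdot U U = (\<Sum>i\<in>UNIV. (a r1 * r1$i + a r2 * r2$i + a r3 * r3$i) * U$i)"
      by (simp add: cdot_def U[symmetric])
    then show ?thesis by (simp add: a_def sum_distrib_left sum.distrib algebra_simps)
  qed
  then have a3: "a r3 * a r3 = 1" using UU a12 by (simp add: algebra_simps)
  have U': "U$i = a r3 * (r3$i + (a r3 * a r1) * Complex (r1$i) (r2$i))" for i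
  proof -
    have "U$i = a r3 * r3$i + (a r3 * a r3) * a r1 * Complex (r1$i) (r2$i)"
      unfolding U[of i] a12 a3 by (simp add: Complex_eq algebra_simps)
    then show ?thesis by (simp add: algebra_simps)
  qed
  show ?thesis
  proof (rule that[OF r(2-4) r3_def])
    show "a r3 * \<rho> \<noteq> 0" using a3 r(1) by auto
    show "A$i$j = (a r3 * \<rho>) * ((r3$i + (a r3 * a r1) * Complex (r1$i) (r2$i)) * Complex (r1$j) (r2$j)
       + Complex (r1$i) (r2$i) * (r3$j + (a r3 * a r1) * Complex (r1$j) (r2$j)))" for i j
      unfolding A L U' by (simp add: algebra_simps)
  qed
qed

section \<open>Adapted null tetrads\<close>

definition spatial :: "real^4^4 \<Rightarrow> real^3 \<Rightarrow> vect" where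
  "spatial \<Theta> x = (\<Sum>j\<in>UNIV. x$j *\<^sub>R \<Theta>$sp_idx j)"

lemma spatial_nth: "spatial \<Theta> x $\<alpha> = x$1 * \<Theta>$1$\<alpha> + x$2 * \<Theta>$2$\<alpha> + x$3 * \<Theta>$3$\<alpha>"
  by (simp add: spatial_def sum_3 sp_idx_simps)

lemma cowedge_spatial0: "cowedge (\<Theta>$0) (spatial \<Theta> x) = (\<Sum>j\<in>UNIV. x$j *\<^sub>R electric \<Theta> j)"
proof -
  have "cowedge (\<Theta>$0) (spatial \<Theta> x) $\<alpha>$\<beta> = (\<Sum>j\<in>UNIV. x$j *\<^sub>R electric \<Theta> j) $\<alpha>$\<beta>" for \<alpha> \<beta>
    unfolding sum_3 electric_def by (simp add: spatial_nth cowedge_def sp_idx_simps) (simp add: algebra_simps)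
  then show ?thesis by (simp add: vec_eq_iff)
qed

lemma cowedge_spatial: "cowedge (spatial \<Theta> x) (spatial \<Theta> y) = (\<Sum>j\<in>UNIV. cross3 x y $j *\<^sub>R magnetic \<Theta> j)"
proof -
  have "cowedge (spatial \<Theta> x) (spatial \<Theta> y) $\<alpha>$\<beta> = (\<Sum>j\<in>UNIV. cross3 x y $j *\<^sub>R magnetic \<Theta> j) $\<alpha>$\<beta>" for \<alpha> \<beta>
    unfolding sum_3 magnetic_def cross_components by (simp add: spatial_nth cowedge_def sp_idx_simps) (simp add: algebra_simps)
  then show ?thesis by (simp add: vec_eq_iff)
qed

text \<open>The dual, extended complex-linearly, multiplies every \<open>sd_form\<close> by \<i>,
  hence also X + \<i> Y.\<close>

lemma hodge2_self_dual:
  assumes cf: "coframe g ori \<Theta>"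
    and XY: "\<And>\<alpha> \<beta>. (\<Sum>i\<in>UNIV. c i * sd_form \<Theta> i $\<alpha>$\<beta>) = Complex (X$\<alpha>$\<beta>) (Y$\<alpha>$\<beta>)"
  shows "hodge2 g ori X = - Y" "hodge2 g ori Y = X"
proof -
  note lin = linear_sum[OF linear_hodge2] linear_add[OF linear_hodge2] linear_scale[OF linear_hodge2]
    linear_diff[OF linear_hodge2] hodge2_electric[OF cf] hodge2_magnetic[OF cf]
  have X: "X = (\<Sum>i\<in>UNIV. Re (c i) *\<^sub>R electric \<Theta> i - Im (c i) *\<^sub>R magnetic \<Theta> i)"
    using XY by (simp add: vec_eq_iff complex_eq_iff sd_form_def sum_component)
  have Y: "Y = (\<Sum>i\<in>UNIV. Re (c i) *\<^sub>R magnetic \<Theta> i + Im (c i) *\<^sub>R electric \<Theta> i)"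
    using XY by (simp add: vec_eq_iff complex_eq_iff sd_form_def sum_component)
  show "hodge2 g ori X = - Y"
    unfolding X Y lin by (simp add: sum_negf[symmetric])
  show "hodge2 g ori Y = X"
    unfolding X Y lin by simp
qed

text \<open>The tetrad consists of covectors. Orientation enters only through the duals of the
  2-forms from which the Weyl tensor is rebuilt.\<close>

locale null_tetrad =
  fixes g :: "real tensor2" and ori :: real and l k m n :: vect
  assumes metric: "g$\<alpha>$\<beta> = - l$\<alpha> * k$\<beta> - k$\<alpha> * l$\<beta> + m$\<alpha> * m$\<beta> + n$\<alpha> * n$\<beta>"
    and inv: "g ** matrix_inv g = mat 1"
    and hodge_lk: "hodge2 g ori (cowedge l k) = - cowedge m n"
    and hodge_lm: "hodge2 g ori (cowedge l m) = - cowedge l n"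
    and hodge_ln: "hodge2 g ori (cowedge l n) = cowedge l m"
begin

abbreviation ip :: "vect \<Rightarrow> vect \<Rightarrow> real" where
  "ip x y \<equiv> x \<bullet> (matrix_inv g *v y)"

text \<open>With the tetrad as rows of \<open>M\<close> the metric is
  \<open>transpose M ** Q ** M\<close>, where \<open>Q\<close> is its own inverse; inverting shows
  that the inverse metric has the Gram matrix \<open>Q\<close>.\<close>

lemma ip_tetrad:
  "ip l l = 0" "ip l k = -1" "ip l m = 0" "ip l n = 0"
  "ip k l = -1" "ip k k = 0" "ip k m = 0" "ip k n = 0"
  "ip m l = 0" "ip m k = 0" "ip m m = 1" "ip m n = 0"
  "ip n l = 0" "ip n k = 0" "ip n m = 0" "ip n n = 1"
proof -
  define M :: "real^4^4" where "M = (\<chi> i. if i = 0 then l else if i = 1 then k else if i = 2 then m else n)"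
  define Q :: "real^4^4" where "Q = (\<chi> i j. if i = 0 then (if j = 1 then -1 else 0) else if i = 1 then (if j = 0 then -1 else 0)
    else if i = j then 1 else 0)"
  have QQ: "Q ** Q = mat 1"
    by (simp add: Q_def vec_eq_iff matrix_matrix_mult_def mat_def forall_UNIV_4 sum_UNIV_4)
  have g: "g = transpose M ** Q ** M"
    by (simp add: vec_eq_iff matrix_matrix_mult_def transpose_def metric)
     (simp add: sum_UNIV_4 Q_def M_def algebra_simps)
  have "det (g ** matrix_inv g) \<noteq> 0" unfolding inv by simp
  then have "det M \<noteq> 0" unfolding det_mul by (simp add: g det_mul)
  then have "invertible M" by (simp add: invertible_det_nz)
  then obtain N where N: "M ** N = mat 1" unfolding invertible_def by blast
  have "matrix_inv g ** g = mat 1" using inv by (simp add: matrix_left_right_inverse)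
  then have "M = M ** matrix_inv g ** g" by (simp add: matrix_mul_assoc[symmetric])
  also have "\<dots> = M ** matrix_inv g ** transpose M ** Q ** M"
    by (subst (2) g) (simp add: matrix_mul_assoc)
  finally have "M ** N = M ** matrix_inv g ** transpose M ** Q ** (M ** N)"
    by (metis matrix_mul_assoc)
  then have I: "M ** matrix_inv g ** transpose M ** Q = mat 1" unfolding N by simp
  have "M ** matrix_inv g ** transpose M = M ** matrix_inv g ** transpose M ** Q ** Q"
    by (simp add: matrix_mul_assoc[symmetric] QQ)
  then have *: "M ** matrix_inv g ** transpose M = Q" unfolding I by simp
  have "M$i \<bullet> (matrix_inv g *v M$j) = Q$i$j" for i j
    unfolding *[symmetric]
    by (simp add: matrix_matrix_mult_def transpose_def inner_vec_def matrix_vector_mult_def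
       sum_UNIV_4 algebra_simps)
  note r = this[unfolded M_def Q_def, simplified]
  show "ip l l = 0" "ip l k = -1" "ip l m = 0" "ip l n = 0"
  "ip k l = -1" "ip k k = 0" "ip k m = 0" "ip k n = 0"
  "ip m l = 0" "ip m k = 0" "ip m m = 1" "ip m n = 0"
  "ip n l = 0" "ip n k = 0" "ip n m = 0" "ip n n = 1"
    using r[of 0 0] r[of 0 1] r[of 0 2] r[of 0 3] r[of 1 0] r[of 1 1] r[of 1 2] r[of 1 3]
     r[of 2 0] r[of 2 1] r[of 2 2] r[of 2 3] r[of 3 0] r[of 3 1] r[of 3 2] r[of 3 3] by simp_all
qed
end

text \<open>The rotation turns \<open>\<Theta>\<close> into \<open>t\<^sub>0, \<dots>, t\<^sub>3\<close>; the null rotation with parameter \<open>cnj \<mu>\<close> fixes \<open>l\<close> and absorbs \<open>\<mu>\<close>.\<close>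

lemma null_tetrad_exists:
  fixes r1 r2 :: "real^3"
  assumes cf: "coframe g ori \<Theta>" and r: "r1 \<bullet> r1 = 1" "r2 \<bullet> r2 = 1" "r1 \<bullet> r2 = 0" "r3 = cross3 r1 r2"
  obtains l k m n where "null_tetrad g ori l k m n"
    "\<And>\<alpha> \<beta>. (\<Sum>i\<in>UNIV. Complex (r1$i) (r2$i) * sd_form \<Theta> i $\<alpha>$\<beta>) = Complex (cowedge l m $\<alpha>$\<beta>) (cowedge l n $\<alpha>$\<beta>)"
    "\<And>\<alpha> \<beta>. (\<Sum>i\<in>UNIV. (r3$i + \<mu> * Complex (r1$i) (r2$i)) * sd_form \<Theta> i $\<alpha>$\<beta>) = Complex (cowedge l k $\<alpha>$\<beta>) (cowedge m n $\<alpha>$\<beta>)"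
proof -
  note on = orthonormal_cross[OF r(1-3), folded r(4)]
  define t0 t1 t2 t3 where "t0 = \<Theta>$0" and "t1 = spatial \<Theta> r1" and "t2 = spatial \<Theta> r2" and "t3 = spatial \<Theta> r3"
  \<comment> \<open>The term \<mu> (r1 + \<i> r2) adds z1 l \<and> t1 + z2 l \<and> t2 to the real
    part t0 \<and> t3, which dictates the t1 and t2 components of k. Its l component is invisible in
    l \<and> k and is chosen to make k null.\<close>
  define z1 z2 where "z1 = Re \<mu>" and "z2 = - Im \<mu>"
  \<comment> \<open>With r3 = r1 \<times> r2, the combination r1 + \<i> r2 belongs to the null
    covector t0 - t3, not to t0 + t3.\<close>
  define l where "l = t0 - t3"
  define m where "m = t1 + z1 *\<^sub>R l"
  define n where "n = t2 + z2 *\<^sub>R l"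
  define k where "k = (1/2) *\<^sub>R (t0 + t3) + z1 *\<^sub>R t1 + z2 *\<^sub>R t2 + ((z1^2 + z2^2)/2) *\<^sub>R l"
  have E: "(\<Sum>i\<in>UNIV. x$i * electric \<Theta> i $\<alpha>$\<beta>) = cowedge t0 (spatial \<Theta> x) $\<alpha>$\<beta>" for x \<alpha> \<beta>
    by (simp add: t0_def cowedge_spatial0 sum_component)
  have M: "(\<Sum>i\<in>UNIV. cross3 x y $i * magnetic \<Theta> i $\<alpha>$\<beta>) = cowedge (spatial \<Theta> x) (spatial \<Theta> y) $\<alpha>$\<beta>" for x y \<alpha> \<beta>
    by (simp add: cowedge_spatial sum_component)
  note EM = E[of r1, folded t1_def] E[of r2, folded t2_def] E[of r3, folded t3_def]
    M[of r2 r3, unfolded on(1), folded t2_def t3_def] M[of r3 r1, unfolded on(2), folded t1_def t3_def]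
    M[of r1 r2, folded r(4), folded t1_def t2_def]
  have L0: "(\<Sum>i\<in>UNIV. Complex (r1$i) (r2$i) * sd_form \<Theta> i $\<alpha>$\<beta>) = Complex (cowedge l t1 $\<alpha>$\<beta>) (cowedge l t2 $\<alpha>$\<beta>)" for \<alpha> \<beta>
  proof -
    have "(\<Sum>i\<in>UNIV. Complex (r1$i) (r2$i) * sd_form \<Theta> i $\<alpha>$\<beta>) =
      Complex ((\<Sum>i\<in>UNIV. r1$i * electric \<Theta> i $\<alpha>$\<beta>) - (\<Sum>i\<in>UNIV. r2$i * magnetic \<Theta> i $\<alpha>$\<beta>))
        ((\<Sum>i\<in>UNIV. r1$i * magnetic \<Theta> i $\<alpha>$\<beta>) + (\<Sum>i\<in>UNIV. r2$i * electric \<Theta> i $\<alpha>$\<beta>))"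
      by (simp add: complex_eq_iff sd_form_def sum.distrib sum_subtractf)
    then show ?thesis unfolding EM by (simp add: l_def cowedge_def algebra_simps)
  qed
  have K0: "(\<Sum>i\<in>UNIV. of_real (r3$i) * sd_form \<Theta> i $\<alpha>$\<beta>) = Complex (cowedge t0 t3 $\<alpha>$\<beta>) (cowedge t1 t2 $\<alpha>$\<beta>)" for \<alpha> \<beta>
    unfolding EM[symmetric] by (simp add: complex_eq_iff sd_form_def)
  have 1: "(\<Sum>i\<in>UNIV. Complex (r1$i) (r2$i) * sd_form \<Theta> i $\<alpha>$\<beta>) = Complex (cowedge l m $\<alpha>$\<beta>) (cowedge l n $\<alpha>$\<beta>)" for \<alpha> \<beta>
    unfolding L0 by (simp add: m_def n_def cowedge_def algebra_simps)
  have 2: "(\<Sum>i\<in>UNIV. (r3$i + \<mu> * Complex (r1$i) (r2$i)) * sd_form \<Theta> i $\<alpha>$\<beta>) = Complex (cowedge l k $\<alpha>$\<beta>) (cowedge m n $\<alpha>$\<beta>)" for \<alpha> \<beta>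
  proof -
    have "(\<Sum>i\<in>UNIV. (r3$i + \<mu> * Complex (r1$i) (r2$i)) * sd_form \<Theta> i $\<alpha>$\<beta>) =
      (\<Sum>i\<in>UNIV. of_real (r3$i) * sd_form \<Theta> i $\<alpha>$\<beta>) + \<mu> * (\<Sum>i\<in>UNIV. Complex (r1$i) (r2$i) * sd_form \<Theta> i $\<alpha>$\<beta>)"
      by (simp add: sum_distrib_left sum.distrib algebra_simps)
    also have "\<dots> = Complex (cowedge l k $\<alpha>$\<beta>) (cowedge m n $\<alpha>$\<beta>)"
      unfolding L0 K0 by (simp add: complex_eq_iff z1_def z2_def k_def m_def n_def)
       (simp add: cowedge_def l_def field_simps)
    finally show ?thesis .
  qed
  have 3: "hodge2 g ori (cowedge l n) = cowedge l m" "hodge2 g ori (cowedge l m) = - cowedge l n" "hodge2 g ori (cowedge l k) = - cowedge m n"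
    using hodge2_self_dual[OF cf 1] hodge2_self_dual[OF cf 2] by auto
  have g: "g$\<alpha>$\<beta> = - l$\<alpha> * k$\<beta> - k$\<alpha> * l$\<beta> + m$\<alpha> * m$\<beta> + n$\<alpha> * n$\<beta>" for \<alpha> \<beta>
  proof -
    have "t1$\<alpha> * t1$\<beta> + t2$\<alpha> * t2$\<beta> + t3$\<alpha> * t3$\<beta> =
      (\<Sum>i\<in>UNIV. \<Sum>j\<in>UNIV. (r1$i * r1$j + r2$i * r2$j + r3$i * r3$j) * (\<Theta>$sp_idx i$\<alpha> * \<Theta>$sp_idx j$\<beta>))"
      by (simp add: t1_def t2_def t3_def spatial_def sum_component sum_product sum.distrib algebra_simps)
    also have "\<dots> = \<Theta>$1$\<alpha> * \<Theta>$1$\<beta> + \<Theta>$2$\<alpha> * \<Theta>$2$\<beta> + \<Theta>$3$\<alpha> * \<Theta>$3$\<beta>"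
      unfolding on(6) by (simp add: sum_3 sp_idx_simps)
    finally have t: "t1$\<alpha> * t1$\<beta> + t2$\<alpha> * t2$\<beta> + t3$\<alpha> * t3$\<beta> = \<dots>" .
    have "g = transpose \<Theta> ** minkowski ** \<Theta>" using cf unfolding coframe_def by metis
    then have "g$\<alpha>$\<beta> = - t0$\<alpha> * t0$\<beta> + (t1$\<alpha> * t1$\<beta> + t2$\<alpha> * t2$\<beta> + t3$\<alpha> * t3$\<beta>)"
      unfolding t t0_def by (simp add: matrix_matrix_mult_def transpose_def minkowski_def sum_UNIV_4)
    also have "\<dots> = - l$\<alpha> * k$\<beta> - k$\<alpha> * l$\<beta> + m$\<alpha> * m$\<beta> + n$\<alpha> * n$\<beta>"
      by (simp add: k_def m_def n_def l_def field_simps power2_eq_square)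
    finally show ?thesis .
  qed
  have "null_tetrad g ori l k m n"
    by unfold_locales (fact g coframe_inverse_metric(2)[OF cf] 3)+
  then show ?thesis using that 1 2 by blast
qed

section \<open>The Bel-Robinson tensor in a null tetrad\<close>

lemma bform_add_left: "bform G (\<lambda>\<kappa>. x \<kappa> + x' \<kappa>) y = bform G x y + bform G x' y"
  and bform_add_right: "bform G y (\<lambda>\<kappa>. x \<kappa> + x' \<kappa>) = bform G y x + bform G y x'"
  and bform_mult_left: "bform G (\<lambda>\<kappa>. c * x \<kappa>) y = c * bform G x y"
  and bform_mult_right: "bform G y (\<lambda>\<kappa>. c * x \<kappa>) = c * bform G y x"
  by (simp_all add: bform_def sum.distrib sum_distrib_left algebra_simps)

lemma bform_of_real: "bform G (\<lambda>\<alpha>. of_real (x$\<alpha>)) (\<lambda>\<alpha>. of_real (y$\<alpha>)) = of_real (x \<bullet> (G *v y))"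
proof -
  have "x \<bullet> (G *v y) = (\<Sum>\<rho>\<in>UNIV. \<Sum>\<kappa>\<in>UNIV. x$\<kappa> * G$\<kappa>$\<rho> * y$\<rho>)"
    by (subst sum.swap) (simp add: inner_vec_def matrix_vector_mult_def sum_distrib_left mult_ac)
  then show ?thesis by (simp add: bform_def)
qed

lemma bform2_add_left: "bform2 G (\<lambda>\<kappa> \<tau>. X \<kappa> \<tau> + X' \<kappa> \<tau>) Y = bform2 G X Y + bform2 G X' Y"
  and bform2_add_right: "bform2 G Y (\<lambda>\<kappa> \<tau>. X \<kappa> \<tau> + X' \<kappa> \<tau>) = bform2 G Y X + bform2 G Y X'"
  by (simp_all add: bform2_def sum.distrib algebra_simps)

lemmas bform_linear = bform_add_left bform_add_right bform_mult_left bform_mult_right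
  bform2_add_left bform2_add_right bform2_mult_left bform2_mult_right bform2_prod bform_of_real

definition sym2 :: "vect \<Rightarrow> vect \<Rightarrow> real tensor2" where
  "sym2 x y = (\<chi> \<alpha> \<beta>. x$\<alpha> * y$\<beta> + y$\<alpha> * x$\<beta>)"

context null_tetrad
begin

definition form_lk :: "complex tensor2" where "form_lk = (\<chi> \<alpha> \<beta>. Complex (cowedge l k $\<alpha>$\<beta>) (cowedge m n $\<alpha>$\<beta>))"
definition form_lm :: "complex tensor2" where "form_lm = (\<chi> \<alpha> \<beta>. Complex (cowedge l m $\<alpha>$\<beta>) (cowedge l n $\<alpha>$\<beta>))"
text \<open>The metric with the sign of its l-k part reversed; in the end it equals \<open>h\<close>
  minus \<open>v\<close>.\<close>

definition sym_lkmn :: "real tensor2" where "sym_lkmn = (\<chi> \<alpha> \<beta>. sym2 l k $\<alpha>$\<beta> + m$\<alpha> * m$\<beta> + n$\<alpha> * n$\<beta>)"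

lemma contract_FF:
  "bform (matrix_inv g) (\<lambda>\<kappa>. form_lk$\<alpha>$\<kappa>) (\<lambda>\<rho>. cnj (form_lk$\<mu>$\<rho>)) = of_real (sym_lkmn$\<alpha>$\<mu>)"
  "bform (matrix_inv g) (\<lambda>\<kappa>. form_lm$\<alpha>$\<kappa>) (\<lambda>\<rho>. cnj (form_lm$\<mu>$\<rho>)) = of_real (2 * l$\<alpha> * l$\<mu>)"
  "bform (matrix_inv g) (\<lambda>\<kappa>. form_lk$\<alpha>$\<kappa>) (\<lambda>\<rho>. cnj (form_lm$\<mu>$\<rho>)) = Complex (sym2 l m $\<alpha>$\<mu>) (- sym2 l n $\<alpha>$\<mu>)"
  "bform (matrix_inv g) (\<lambda>\<kappa>. form_lm$\<alpha>$\<kappa>) (\<lambda>\<rho>. cnj (form_lk$\<mu>$\<rho>)) = Complex (sym2 l m $\<alpha>$\<mu>) (sym2 l n $\<alpha>$\<mu>)"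
proof -
  have K: "form_lk$\<alpha>$\<kappa> = of_real (l$\<alpha>) * of_real (k$\<kappa>) + (- of_real (k$\<alpha>)) * of_real (l$\<kappa>)
      + (\<i> * of_real (m$\<alpha>)) * of_real (n$\<kappa>) + (- \<i> * of_real (n$\<alpha>)) * of_real (m$\<kappa>)" for \<alpha> \<kappa>
    by (simp add: form_lk_def cowedge_def complex_eq_iff)
  have L: "form_lm$\<alpha>$\<kappa> = of_real (l$\<alpha>) * of_real (m$\<kappa>) + (\<i> * of_real (l$\<alpha>)) * of_real (n$\<kappa>)
      + (- of_real (m$\<alpha>) - \<i> * of_real (n$\<alpha>)) * of_real (l$\<kappa>)" for \<alpha> \<kappa>
    by (simp add: form_lm_def cowedge_def complex_eq_iff)
  have cK: "cnj (form_lk$\<alpha>$\<kappa>) = of_real (l$\<alpha>) * of_real (k$\<kappa>) + (- of_real (k$\<alpha>)) * of_real (l$\<kappa>)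
      + (- \<i> * of_real (m$\<alpha>)) * of_real (n$\<kappa>) + (\<i> * of_real (n$\<alpha>)) * of_real (m$\<kappa>)" for \<alpha> \<kappa>
    by (simp add: form_lk_def cowedge_def complex_eq_iff)
  have cL: "cnj (form_lm$\<alpha>$\<kappa>) = of_real (l$\<alpha>) * of_real (m$\<kappa>) + (- \<i> * of_real (l$\<alpha>)) * of_real (n$\<kappa>)
      + (- of_real (m$\<alpha>) + \<i> * of_real (n$\<alpha>)) * of_real (l$\<kappa>)" for \<alpha> \<kappa>
    by (simp add: form_lm_def cowedge_def complex_eq_iff)
  \<comment> \<open>Below, the conjugates are rewritten before \<open>K\<close> and
    \<open>L\<close>, which would also match inside \<open>cnj\<close>.\<close>
  show "bform (matrix_inv g) (\<lambda>\<kappa>. form_lk$\<alpha>$\<kappa>) (\<lambda>\<rho>. cnj (form_lk$\<mu>$\<rho>)) = of_real (sym_lkmn$\<alpha>$\<mu>)"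
    unfolding cK unfolding K bform_linear ip_tetrad by (simp add: sym_lkmn_def sym2_def complex_eq_iff)
  show "bform (matrix_inv g) (\<lambda>\<kappa>. form_lm$\<alpha>$\<kappa>) (\<lambda>\<rho>. cnj (form_lm$\<mu>$\<rho>)) = of_real (2 * l$\<alpha> * l$\<mu>)"
    unfolding cL unfolding L bform_linear ip_tetrad by (simp add: complex_eq_iff)
  show "bform (matrix_inv g) (\<lambda>\<kappa>. form_lk$\<alpha>$\<kappa>) (\<lambda>\<rho>. cnj (form_lm$\<mu>$\<rho>)) = Complex (sym2 l m $\<alpha>$\<mu>) (- sym2 l n $\<alpha>$\<mu>)"
    unfolding cL unfolding K bform_linear ip_tetrad by (simp add: sym2_def complex_eq_iff)
  show "bform (matrix_inv g) (\<lambda>\<kappa>. form_lm$\<alpha>$\<kappa>) (\<lambda>\<rho>. cnj (form_lk$\<mu>$\<rho>)) = Complex (sym2 l m $\<alpha>$\<mu>) (sym2 l n $\<alpha>$\<mu>)"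
    unfolding cK unfolding L bform_linear ip_tetrad by (simp add: sym2_def complex_eq_iff)
qed

text \<open>The Bel-Robinson tensor of Petrov type III, written out in its adapted tetrad.\<close>

definition type_III :: "real \<Rightarrow> real tensor4" where
  "type_III c = (\<chi> \<alpha> \<mu> \<beta> \<nu>. c * (sym_lkmn$\<alpha>$\<mu> * (l$\<beta> * l$\<nu>) + l$\<alpha> * l$\<mu> * sym_lkmn$\<beta>$\<nu>
     + sym2 l m $\<alpha>$\<mu> * sym2 l m $\<beta>$\<nu> + sym2 l n $\<alpha>$\<mu> * sym2 l n $\<beta>$\<nu>))"

text \<open>The scalar enters only as z times its conjugate, which is where the phase is lost. The
  two mixed contractions are conjugate to each other, so their products add up to twice a real
  part.\<close>

lemma bel_robinson_type_III:
  assumes V: "\<And>\<alpha> \<beta> \<mu> \<nu>. self_dual_weyl g ori W $\<alpha>$\<beta>$\<mu>$\<nu> = z * (form_lk$\<alpha>$\<beta> * form_lm$\<mu>$\<nu> + form_lm$\<alpha>$\<beta> * form_lk$\<mu>$\<nu>)"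
  shows "bel_robinson g ori W = type_III (2 * (cmod z)\<^sup>2)"
proof -
  let ?V = "self_dual_weyl g ori W"
  have e: "bel_robinson g ori W $\<alpha>$\<mu>$\<beta>$\<nu> = Re (bform2 (matrix_inv g) (\<lambda>\<kappa> \<tau>. ?V$\<alpha>$\<kappa>$\<beta>$\<tau>) (\<lambda>\<rho> \<sigma>. cnj (?V$\<mu>$\<rho>$\<nu>$\<sigma>)))" for \<alpha> \<mu> \<beta> \<nu>
    unfolding bel_robinson_def Let_def bform2_def by simp
  have V1: "?V$\<alpha>$\<kappa>$\<beta>$\<tau> = z * (form_lk$\<alpha>$\<kappa> * form_lm$\<beta>$\<tau> + form_lm$\<alpha>$\<kappa> * form_lk$\<beta>$\<tau>)" for \<alpha> \<beta> \<kappa> \<tau> by (rule V)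
  have V2: "cnj (?V$\<alpha>$\<kappa>$\<beta>$\<tau>) = cnj z * (cnj (form_lk$\<alpha>$\<kappa>) * cnj (form_lm$\<beta>$\<tau>) + cnj (form_lm$\<alpha>$\<kappa>) * cnj (form_lk$\<beta>$\<tau>))" for \<alpha> \<beta> \<kappa> \<tau>
    unfolding V by simp
  have "bel_robinson g ori W $\<alpha>$\<mu>$\<beta>$\<nu> = type_III (2 * (cmod z)\<^sup>2) $\<alpha>$\<mu>$\<beta>$\<nu>" for \<alpha> \<mu> \<beta> \<nu>
  proof -
    have "bel_robinson g ori W $\<alpha>$\<mu>$\<beta>$\<nu> = Re ((z * cnj z) * of_real (type_III 2 $\<alpha>$\<mu>$\<beta>$\<nu>))"
      unfolding e V2 unfolding V1 bform_linear contract_FF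
      by (rule arg_cong[of _ _ Re]) (simp add: complex_eq_iff type_III_def algebra_simps)
    also have "z * cnj z = of_real ((cmod z)\<^sup>2)" by (simp only: complex_norm_square)
    finally show ?thesis by (simp add: type_III_def)
  qed
  then show ?thesis by (simp add: vec_eq_iff)
qed

text \<open>Among the contractions of inner factors only that of \<open>sym_lkmn\<close> with itself
  survives, and it equals 4. The others vanish because l is null and orthogonal to m and n, and m is
  orthogonal to n.\<close>

lemma tensor_comp_type_III:
  "tensor_comp g (type_III c) (type_III c) $\<alpha>$\<beta>$\<rho>$\<sigma> = 4 * c\<^sup>2 * (l$\<alpha> * l$\<beta> * (l$\<rho> * l$\<sigma>))"
proof -
  let ?r = complex_of_real
  have 0: "?r (tensor_comp g (type_III c) (type_III c) $\<alpha>$\<beta>$\<rho>$\<sigma>) = bform2 (matrix_inv g)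
     (\<lambda>\<kappa> \<tau>. ?r (type_III c $\<alpha>$\<beta>$\<kappa>$\<tau>)) (\<lambda>\<mu> \<nu>. ?r (type_III c $\<mu>$\<nu>$\<rho>$\<sigma>))"
    by (simp add: tensor_comp_def bform2_def)
  have 1: "?r (type_III c $\<alpha>$\<beta>$\<kappa>$\<tau>) = ?r (c * sym_lkmn$\<alpha>$\<beta>) * (?r (l$\<kappa>) * ?r (l$\<tau>))
     + ?r (c * l$\<alpha> * l$\<beta>) * (?r (l$\<kappa>) * ?r (k$\<tau>)) + ?r (c * l$\<alpha> * l$\<beta>) * (?r (k$\<kappa>) * ?r (l$\<tau>))
     + ?r (c * l$\<alpha> * l$\<beta>) * (?r (m$\<kappa>) * ?r (m$\<tau>)) + ?r (c * l$\<alpha> * l$\<beta>) * (?r (n$\<kappa>) * ?r (n$\<tau>))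
     + ?r (c * sym2 l m $\<alpha>$\<beta>) * (?r (l$\<kappa>) * ?r (m$\<tau>)) + ?r (c * sym2 l m $\<alpha>$\<beta>) * (?r (m$\<kappa>) * ?r (l$\<tau>))
     + ?r (c * sym2 l n $\<alpha>$\<beta>) * (?r (l$\<kappa>) * ?r (n$\<tau>)) + ?r (c * sym2 l n $\<alpha>$\<beta>) * (?r (n$\<kappa>) * ?r (l$\<tau>))"
    for \<alpha> \<beta> \<kappa> \<tau>
    by (simp add: type_III_def sym_lkmn_def sym2_def algebra_simps)
  \<comment> \<open>Exchanging the index pairs brings the second factor into the form to which
    expansion \<open>1\<close> applies.\<close>
  have 2: "type_III c $\<mu>$\<nu>$\<rho>$\<sigma> = type_III c $\<rho>$\<sigma>$\<mu>$\<nu>" for \<mu> \<nu> \<rho> \<sigma>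
    by (simp add: type_III_def algebra_simps)
  have "(\<lambda>\<mu> \<nu>. ?r (type_III c $\<mu>$\<nu>$\<rho>$\<sigma>)) = (\<lambda>\<mu> \<nu>. ?r (type_III c $\<rho>$\<sigma>$\<mu>$\<nu>))"
    by (intro ext arg_cong[of _ _ ?r] 2)
  with 0 have "?r (tensor_comp g (type_III c) (type_III c) $\<alpha>$\<beta>$\<rho>$\<sigma>) = bform2 (matrix_inv g)
     (\<lambda>\<kappa> \<tau>. ?r (type_III c $\<alpha>$\<beta>$\<kappa>$\<tau>)) (\<lambda>\<mu> \<nu>. ?r (type_III c $\<rho>$\<sigma>$\<mu>$\<nu>))"
    by simp
  also have "\<dots> = ?r (4 * c\<^sup>2 * (l$\<alpha> * l$\<beta> * (l$\<rho> * l$\<sigma>)))"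
    unfolding 1 bform_linear ip_tetrad by (simp add: power2_eq_square)
  finally show ?thesis by (simp only: of_real_eq_iff)
qed

end

section \<open>Contractions of 4- and 6-tensors with u \<otimes> u\<close>

lemma apply4_outer: "apply4 S (outer_vec u u) $\<alpha>$\<beta> = (\<Sum>\<mu>\<in>UNIV. \<Sum>\<nu>\<in>UNIV. S$\<alpha>$\<beta>$\<mu>$\<nu> * (u$\<mu> * u$\<nu>))"
  by (simp add: apply4_def outer_vec_def)

lemma bil_eq: "bil A y z = y \<bullet> (A *v z)"
  by (simp add: bil_def inner_vec_def matrix_vector_mult_def sum_distrib_left mult_ac)

lemma bil_outer: "bil A u u = (\<Sum>\<alpha>\<in>UNIV. \<Sum>\<beta>\<in>UNIV. A$\<alpha>$\<beta> * (u$\<alpha> * u$\<beta>))"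
  by (simp add: bil_def mult_ac)

lemma quad4_outer: "quad4 S (outer_vec u u) = bil (apply4 S (outer_vec u u)) u u"
  unfolding quad4_def bil_outer apply4_outer
  by (simp add: outer_vec_def sum_distrib_left sum_distrib_right mult_ac)

lemma cubic6_outer: "cubic6 R (outer_vec u u) = bil (apply6 R (outer_vec u u)) u u"
  unfolding cubic6_def bil_outer by (simp add: outer_vec_def)

text \<open>Contracting with \<open>u\<close> before summing over \<epsilon> and \<kappa> reduces
  the 6-tensor to one inner product of two covectors.\<close>

lemma apply6_tensor_dot:
  fixes T :: "real tensor4" and u :: vect
  defines "Z \<equiv> apply4 T (outer_vec u u)"
  shows "(\<Sum>\<mu>\<in>UNIV. \<Sum>\<nu>\<in>UNIV. \<Sum>\<rho>\<in>UNIV. \<Sum>\<sigma>\<in>UNIV.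
      tensor_dot g T T $\<alpha>$\<beta>$\<rho>$\<sigma>$\<mu>$\<nu> * (u$\<mu> * u$\<nu>) * (u$\<rho> * u$\<sigma>)) =
    (\<chi> \<epsilon>. \<Sum>\<rho>\<in>UNIV. T$\<alpha>$\<beta>$\<rho>$\<epsilon> * u$\<rho>) \<bullet> (matrix_inv g *v (Z *v u))"
proof -
  let ?t = "tensor_dot g T T"
  have 1: "(\<Sum>\<mu>\<in>UNIV. \<Sum>\<nu>\<in>UNIV. ?t $\<alpha>$\<beta>$\<rho>$\<sigma>$\<mu>$\<nu> * (u$\<mu> * u$\<nu>)) =
     (\<Sum>\<epsilon>\<in>UNIV. \<Sum>\<kappa>\<in>UNIV. T$\<alpha>$\<beta>$\<rho>$\<epsilon> * matrix_inv g $\<epsilon>$\<kappa> * Z$\<kappa>$\<sigma>)" for \<rho> \<sigma>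
    unfolding tensor_dot_def Z_def apply4_outer vec_lambda_beta sum_distrib_left sum_distrib_right
    by (subst sum_UNIV_4_swap) (simp add: mult_ac)
  have "(\<Sum>\<mu>\<in>UNIV. \<Sum>\<nu>\<in>UNIV. \<Sum>\<rho>\<in>UNIV. \<Sum>\<sigma>\<in>UNIV. ?t $\<alpha>$\<beta>$\<rho>$\<sigma>$\<mu>$\<nu> * (u$\<mu> * u$\<nu>) * (u$\<rho> * u$\<sigma>)) =
     (\<Sum>\<rho>\<in>UNIV. \<Sum>\<sigma>\<in>UNIV. (\<Sum>\<mu>\<in>UNIV. \<Sum>\<nu>\<in>UNIV. ?t $\<alpha>$\<beta>$\<rho>$\<sigma>$\<mu>$\<nu> * (u$\<mu> * u$\<nu>)) * (u$\<rho> * u$\<sigma>))"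
    by (subst sum_UNIV_4_swap) (simp only: sum_distrib_right)
  also have "\<dots> = (\<Sum>\<epsilon>\<in>UNIV. \<Sum>\<kappa>\<in>UNIV. \<Sum>\<rho>\<in>UNIV. \<Sum>\<sigma>\<in>UNIV. (T$\<alpha>$\<beta>$\<rho>$\<epsilon> * matrix_inv g $\<epsilon>$\<kappa> * Z$\<kappa>$\<sigma>) * (u$\<rho> * u$\<sigma>))"
    unfolding 1 sum_distrib_right by (rule sum_UNIV_4_swap)
  also have "\<dots> = (\<Sum>\<epsilon>\<in>UNIV. \<Sum>\<kappa>\<in>UNIV. (\<Sum>\<rho>\<in>UNIV. T$\<alpha>$\<beta>$\<rho>$\<epsilon> * u$\<rho>) * matrix_inv g $\<epsilon>$\<kappa> * (Z *v u)$\<kappa>)"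
    unfolding matrix_vector_mult_def vec_lambda_beta sum_distrib_left sum_distrib_right
    by (rule sum.cong[OF refl], rule sum.cong[OF refl], subst sum.swap) (simp add: mult_ac)
  also have "\<dots> = (\<chi> \<epsilon>. \<Sum>\<rho>\<in>UNIV. T$\<alpha>$\<beta>$\<rho>$\<epsilon> * u$\<rho>) \<bullet> (matrix_inv g *v (Z *v u))"
    by (simp add: inner_vec_def matrix_vector_mult_def[of "matrix_inv g"] sum_distrib_left mult.assoc)
  finally show ?thesis .
qed

text \<open>The two T \<cdot> T terms agree because u \<otimes> u is symmetric in \<rho> and
  \<sigma>; this absorbs the factor 2 in front of \<open>R\<close>.\<close>

lemma apply6_outer:
  assumes R: "\<forall>\<alpha> \<beta> \<mu> \<nu> \<rho> \<sigma>. 2 * R$\<alpha>$\<beta>$\<mu>$\<nu>$\<rho>$\<sigma> =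
           tensor_dot g T T $\<alpha>$\<beta>$\<rho>$\<sigma>$\<mu>$\<nu> + tensor_dot g T T $\<alpha>$\<beta>$\<sigma>$\<rho>$\<mu>$\<nu>
           - T$\<alpha>$\<beta>$\<mu>$\<nu> * \<Lambda>$\<rho>$\<sigma> - 1/2 * T2$\<alpha>$\<beta>$\<mu>$\<nu> * g$\<rho>$\<sigma>"
  shows "apply6 R (outer_vec u u) $\<alpha>$\<beta> =
    (\<chi> \<epsilon>. \<Sum>\<rho>\<in>UNIV. T$\<alpha>$\<beta>$\<rho>$\<epsilon> * u$\<rho>) \<bullet> (matrix_inv g *v (apply4 T (outer_vec u u) *v u))
    - 1/2 * apply4 T (outer_vec u u) $\<alpha>$\<beta> * bil \<Lambda> u u - 1/4 * apply4 T2 (outer_vec u u) $\<alpha>$\<beta> * bil g u u"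
    (is "_ = ?E - _ - _")
proof -
  let ?t = "tensor_dot g T T"
  have "2 * apply6 R (outer_vec u u) $\<alpha>$\<beta> = (\<Sum>\<mu>\<in>UNIV. \<Sum>\<nu>\<in>UNIV. \<Sum>\<rho>\<in>UNIV. \<Sum>\<sigma>\<in>UNIV.
     (2 * R$\<alpha>$\<beta>$\<mu>$\<nu>$\<rho>$\<sigma>) * (u$\<mu> * u$\<nu>) * (u$\<rho> * u$\<sigma>))"
    by (simp add: apply6_def outer_vec_def sum_distrib_left mult_ac)
  also have "\<dots> = (\<Sum>\<mu>\<in>UNIV. \<Sum>\<nu>\<in>UNIV. \<Sum>\<rho>\<in>UNIV. \<Sum>\<sigma>\<in>UNIV.
      ?t $\<alpha>$\<beta>$\<rho>$\<sigma>$\<mu>$\<nu> * (u$\<mu> * u$\<nu>) * (u$\<rho> * u$\<sigma>)) + (\<Sum>\<mu>\<in>UNIV. \<Sum>\<nu>\<in>UNIV. \<Sum>\<rho>\<in>UNIV. \<Sum>\<sigma>\<in>UNIV.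
      ?t $\<alpha>$\<beta>$\<sigma>$\<rho>$\<mu>$\<nu> * (u$\<mu> * u$\<nu>) * (u$\<rho> * u$\<sigma>))
      - (\<Sum>\<mu>\<in>UNIV. \<Sum>\<nu>\<in>UNIV. \<Sum>\<rho>\<in>UNIV. \<Sum>\<sigma>\<in>UNIV. (T$\<alpha>$\<beta>$\<mu>$\<nu> * (u$\<mu> * u$\<nu>)) * (\<Lambda>$\<rho>$\<sigma> * (u$\<rho> * u$\<sigma>)))
      - 1/2 * (\<Sum>\<mu>\<in>UNIV. \<Sum>\<nu>\<in>UNIV. \<Sum>\<rho>\<in>UNIV. \<Sum>\<sigma>\<in>UNIV. (T2$\<alpha>$\<beta>$\<mu>$\<nu> * (u$\<mu> * u$\<nu>)) * (g$\<rho>$\<sigma> * (u$\<rho> * u$\<sigma>)))"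
    unfolding R[rule_format] sum_distrib_left sum.distrib[symmetric] sum_subtractf[symmetric]
    by (intro sum.cong refl) (simp add: algebra_simps)
  also have "(\<Sum>\<mu>\<in>UNIV. \<Sum>\<nu>\<in>UNIV. \<Sum>\<rho>\<in>UNIV. \<Sum>\<sigma>\<in>UNIV. ?t $\<alpha>$\<beta>$\<sigma>$\<rho>$\<mu>$\<nu> * (u$\<mu> * u$\<nu>) * (u$\<rho> * u$\<sigma>)) = ?E"
    unfolding apply6_tensor_dot[symmetric]
    by (rule sum.cong[OF refl], rule sum.cong[OF refl], subst sum.swap) (simp add: mult_ac)
  also have "(\<Sum>\<mu>\<in>UNIV. \<Sum>\<nu>\<in>UNIV. \<Sum>\<rho>\<in>UNIV. \<Sum>\<sigma>\<in>UNIV. (T$\<alpha>$\<beta>$\<mu>$\<nu> * (u$\<mu> * u$\<nu>)) * (\<Lambda>$\<rho>$\<sigma> * (u$\<rho> * u$\<sigma>)))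
     = apply4 T (outer_vec u u) $\<alpha>$\<beta> * bil \<Lambda> u u"
    by (subst sum_UNIV_4_swap) (simp only: apply4_outer bil_outer sum_distrib_left sum_distrib_right)
  also have "(\<Sum>\<mu>\<in>UNIV. \<Sum>\<nu>\<in>UNIV. \<Sum>\<rho>\<in>UNIV. \<Sum>\<sigma>\<in>UNIV. (T2$\<alpha>$\<beta>$\<mu>$\<nu> * (u$\<mu> * u$\<nu>)) * (g$\<rho>$\<sigma> * (u$\<rho> * u$\<sigma>)))
     = apply4 T2 (outer_vec u u) $\<alpha>$\<beta> * bil g u u"
    by (subst sum_UNIV_4_swap) (simp only: apply4_outer bil_outer sum_distrib_left sum_distrib_right)
  finally show ?thesis unfolding apply6_tensor_dot by simp
qed

context null_tetrad
begin

lemma sum_mult_inner: "(\<Sum>\<nu>\<in>UNIV. x$\<nu> * u$\<nu>) = x \<bullet> u" for x u :: vect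
  by (simp add: inner_vec_def)

lemma type_III_apply1:
  "(\<chi> \<epsilon>. \<Sum>\<rho>\<in>UNIV. type_III c $\<alpha>$\<beta>$\<rho>$\<epsilon> * u$\<rho>) = c *\<^sub>R (sym_lkmn$\<alpha>$\<beta> *\<^sub>R (l \<bullet> u) *\<^sub>R l
     + (l$\<alpha> * l$\<beta>) *\<^sub>R ((k \<bullet> u) *\<^sub>R l + (l \<bullet> u) *\<^sub>R k + (m \<bullet> u) *\<^sub>R m + (n \<bullet> u) *\<^sub>R n)
     + sym2 l m $\<alpha>$\<beta> *\<^sub>R ((m \<bullet> u) *\<^sub>R l + (l \<bullet> u) *\<^sub>R m)
     + sym2 l n $\<alpha>$\<beta> *\<^sub>R ((n \<bullet> u) *\<^sub>R l + (l \<bullet> u) *\<^sub>R n))"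
proof -
  \<comment> \<open>The factors carrying \<alpha> and \<beta> are generalised to scalars A, B, C, D,
    so that the componentwise expansion does not open them.\<close>
  have "(\<Sum>\<rho>\<in>UNIV. (c * (A * (l$\<rho> * l$\<epsilon>) + B * (sym2 l k $\<rho>$\<epsilon> + m$\<rho> * m$\<epsilon> + n$\<rho> * n$\<epsilon>) + C * sym2 l m $\<rho>$\<epsilon> + D * sym2 l n $\<rho>$\<epsilon>)) * u$\<rho>) =
     (c *\<^sub>R (A *\<^sub>R (l \<bullet> u) *\<^sub>R l
     + B *\<^sub>R ((k \<bullet> u) *\<^sub>R l + (l \<bullet> u) *\<^sub>R k + (m \<bullet> u) *\<^sub>R m + (n \<bullet> u) *\<^sub>R n)
     + C *\<^sub>R ((m \<bullet> u) *\<^sub>R l + (l \<bullet> u) *\<^sub>R m)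
     + D *\<^sub>R ((n \<bullet> u) *\<^sub>R l + (l \<bullet> u) *\<^sub>R n))) $ \<epsilon>" for \<epsilon> A B C D
    by (simp add: inner_vec_def sum_UNIV_4 sym2_def) (simp add: algebra_simps)
  then show ?thesis by (simp add: vec_eq_iff type_III_def sym_lkmn_def)
qed

lemma type_III_apply2:
  "apply4 (type_III c) (outer_vec u u) $\<alpha>$\<beta> = c * (sym_lkmn$\<alpha>$\<beta> * (l \<bullet> u)\<^sup>2
     + l$\<alpha> * l$\<beta> * (2 * (l \<bullet> u) * (k \<bullet> u) + (m \<bullet> u)\<^sup>2 + (n \<bullet> u)\<^sup>2)
     + sym2 l m $\<alpha>$\<beta> * (2 * (l \<bullet> u) * (m \<bullet> u)) + sym2 l n $\<alpha>$\<beta> * (2 * (l \<bullet> u) * (n \<bullet> u)))"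
proof -
  have "apply4 (type_III c) (outer_vec u u) $\<alpha>$\<beta> = (\<Sum>\<epsilon>\<in>UNIV. (\<chi> \<epsilon>. \<Sum>\<rho>\<in>UNIV. type_III c $\<alpha>$\<beta>$\<rho>$\<epsilon> * u$\<rho>)$\<epsilon> * u$\<epsilon>)"
    unfolding apply4_outer by (subst sum.swap) (simp add: sum_distrib_left mult_ac)
  also have "\<dots> = (\<chi> \<epsilon>. \<Sum>\<rho>\<in>UNIV. type_III c $\<alpha>$\<beta>$\<rho>$\<epsilon> * u$\<rho>) \<bullet> u"
    by (rule sum_mult_inner)
  finally show ?thesis
    unfolding type_III_apply1 by (simp add: inner_add_left power2_eq_square algebra_simps)
qed

lemma type_III_apply3:
  "apply4 (type_III c) (outer_vec u u) *v u = c *\<^sub>R ((l \<bullet> u)\<^sup>2 *\<^sub>R ((k \<bullet> u) *\<^sub>R l + (l \<bullet> u) *\<^sub>R k + (m \<bullet> u) *\<^sub>R m + (n \<bullet> u) *\<^sub>R n)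
     + ((2 * (l \<bullet> u) * (k \<bullet> u) + (m \<bullet> u)\<^sup>2 + (n \<bullet> u)\<^sup>2) * (l \<bullet> u)) *\<^sub>R l
     + (2 * (l \<bullet> u) * (m \<bullet> u)) *\<^sub>R ((m \<bullet> u) *\<^sub>R l + (l \<bullet> u) *\<^sub>R m)
     + (2 * (l \<bullet> u) * (n \<bullet> u)) *\<^sub>R ((n \<bullet> u) *\<^sub>R l + (l \<bullet> u) *\<^sub>R n))"
proof -
  have "(\<Sum>\<beta>\<in>UNIV. c * ((sym2 l k $\<alpha>$\<beta> + m$\<alpha> * m$\<beta> + n$\<alpha> * n$\<beta>) * A + l$\<alpha> * l$\<beta> * B + sym2 l m $\<alpha>$\<beta> * C + sym2 l n $\<alpha>$\<beta> * D) * u$\<beta>) =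
    (c *\<^sub>R (A *\<^sub>R ((k \<bullet> u) *\<^sub>R l + (l \<bullet> u) *\<^sub>R k + (m \<bullet> u) *\<^sub>R m + (n \<bullet> u) *\<^sub>R n)
     + (B * (l \<bullet> u)) *\<^sub>R l
     + C *\<^sub>R ((m \<bullet> u) *\<^sub>R l + (l \<bullet> u) *\<^sub>R m)
     + D *\<^sub>R ((n \<bullet> u) *\<^sub>R l + (l \<bullet> u) *\<^sub>R n))) $ \<alpha>" for \<alpha> A B C D
    by (simp add: inner_vec_def sum_UNIV_4 sym2_def) (simp add: algebra_simps)
  then show ?thesis by (simp add: vec_eq_iff matrix_vector_mult_def type_III_apply2 sym_lkmn_def)
qed

lemma bil_metric: "bil g u u = - 2 * (l \<bullet> u) * (k \<bullet> u) + (m \<bullet> u)\<^sup>2 + (n \<bullet> u)\<^sup>2"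
proof -
  have "g *v u = - (k \<bullet> u) *\<^sub>R l - (l \<bullet> u) *\<^sub>R k + (m \<bullet> u) *\<^sub>R m + (n \<bullet> u) *\<^sub>R n"
    by (simp add: vec_eq_iff matrix_vector_mult_def inner_vec_def sum_UNIV_4 metric algebra_simps)
  then show ?thesis unfolding bil_eq
    by (simp add: inner_add_right inner_diff_right inner_commute[of u] power2_eq_square)
qed

lemma type_III_dot:
  "(\<chi> \<epsilon>. \<Sum>\<rho>\<in>UNIV. type_III c $\<alpha>$\<beta>$\<rho>$\<epsilon> * u$\<rho>) \<bullet> (matrix_inv g *v (apply4 (type_III c) (outer_vec u u) *v u))
   = c\<^sup>2 * (- sym_lkmn$\<alpha>$\<beta> * (l \<bullet> u)^4 - 4 * (l$\<alpha> * l$\<beta>) * (l \<bullet> u)^3 * (k \<bullet> u)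
     + 2 * (l \<bullet> u)^3 * (sym2 l m $\<alpha>$\<beta> * (m \<bullet> u) + sym2 l n $\<alpha>$\<beta> * (n \<bullet> u)))"
  unfolding type_III_apply1 type_III_apply3
  by (simp add: inner_add_left inner_add_right matrix_vector_right_distrib matrix_vector_mult_scaleR ip_tetrad)
   (simp add: algebra_simps power2_eq_square power3_eq_cube power4_eq_xxxx)

end

section \<open>Reconstruction of the Weyl tensor\<close>

context null_tetrad
begin

text \<open>On the hyperplane l \<bullet> u = 0 the metric reduces to the squares of the m and n
  components, so no time-like vector lies in it.\<close>

lemma timelike_imp_nonzero: "timelike g u \<Longrightarrow> l \<bullet> u \<noteq> 0"
proof
  assume "timelike g u" "l \<bullet> u = 0"
  then have "(m \<bullet> u)\<^sup>2 + (n \<bullet> u)\<^sup>2 < 0" by (simp add: timelike_def bil_metric)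
  then show False using sum_power2_ge_zero[of "m \<bullet> u" "n \<bullet> u"] by linarith
qed

lemma outer_square_mult_vec:
  assumes "\<And>\<alpha> \<beta>. A$\<alpha>$\<beta> = c * (x$\<alpha> * x$\<beta>)"
  shows "A *v u = (c * (x \<bullet> u)) *\<^sub>R (x::vect)"
  by (simp add: vec_eq_iff matrix_vector_mult_def assms inner_vec_def sum_distrib_left sum_distrib_right mult_ac)

lemma type_III_reconstruction:
  assumes c: "c > 0" and u: "timelike g u" and T: "T = type_III c" and T2: "T2 = tensor_comp g T T"
    and X: "X = outer_vec u u"
    and \<Lambda>: "\<Lambda> = (1 / sqrt (quad4 T2 X)) *\<^sub>R apply4 T2 X"
    and R: "\<forall>\<alpha> \<beta> \<mu> \<nu> \<rho> \<sigma>. 2 * R$\<alpha>$\<beta>$\<mu>$\<nu>$\<rho>$\<sigma> =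
           tensor_dot g T T $\<alpha>$\<beta>$\<rho>$\<sigma>$\<mu>$\<nu> + tensor_dot g T T $\<alpha>$\<beta>$\<sigma>$\<rho>$\<mu>$\<nu>
           - T$\<alpha>$\<beta>$\<mu>$\<nu> * \<Lambda>$\<rho>$\<sigma> - 1/2 * T2$\<alpha>$\<beta>$\<mu>$\<nu> * g$\<rho>$\<sigma>"
    and \<pi>: "\<pi> = (1 / quad4 T2 X) *\<^sub>R
           (apply6 R X - (cubic6 R X / (2 * quad4 T2 X)) *\<^sub>R apply4 T2 X)"
  shows "quad4 T2 X = 4 * c\<^sup>2 * (l \<bullet> u)^4"
    and "\<Lambda>$\<alpha>$\<beta> = 2 * c * (l$\<alpha> * l$\<beta>)"
    and "\<pi>$\<alpha>$\<beta> = - (1/2) * sym_lkmn$\<alpha>$\<beta>"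
proof -
  define a where "a = l \<bullet> u"
  have a: "a \<noteq> 0" using timelike_imp_nonzero[OF u] by (simp add: a_def)
  have A2: "apply4 T2 X $\<alpha>$\<beta> = 4 * c\<^sup>2 * a\<^sup>2 * (l$\<alpha> * l$\<beta>)" for \<alpha> \<beta>
  proof -
    have "apply4 T2 X $\<alpha>$\<beta> = 4 * c\<^sup>2 * (l$\<alpha> * l$\<beta>) * (\<Sum>\<mu>\<in>UNIV. \<Sum>\<nu>\<in>UNIV. (l$\<mu> * u$\<mu>) * (l$\<nu> * u$\<nu>))"
      unfolding X apply4_outer T2 T tensor_comp_type_III by (simp add: sum_distrib_left mult_ac)
    also have "(\<Sum>\<mu>\<in>UNIV. \<Sum>\<nu>\<in>UNIV. (l$\<mu> * u$\<mu>) * (l$\<nu> * u$\<nu>)) = a\<^sup>2"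
      by (simp add: a_def inner_vec_def power2_eq_square sum_product)
    finally show ?thesis by (simp add: mult_ac)
  qed
  have Q: "quad4 T2 X = 4 * c\<^sup>2 * a^4"
    unfolding X quad4_outer unfolding X[symmetric] bil_eq outer_square_mult_vec[OF A2]
    by (simp add: a_def[symmetric] inner_commute[of u] power2_eq_square power4_eq_xxxx)
  then show "quad4 T2 X = 4 * c\<^sup>2 * (l \<bullet> u)^4" by (simp add: a_def)
  have "4 * c\<^sup>2 * a^4 = (2 * c * a\<^sup>2)\<^sup>2" by (simp add: power2_eq_square power4_eq_xxxx)
  then have sQ: "sqrt (quad4 T2 X) = 2 * c * a\<^sup>2" unfolding Q using c by (simp only: real_sqrt_abs) simp
  have L: "\<Lambda>$\<alpha>$\<beta> = 2 * c * (l$\<alpha> * l$\<beta>)" for \<alpha> \<beta>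
    unfolding \<Lambda> sQ using a c by (simp add: A2 power2_eq_square field_simps)
  then show "\<Lambda>$\<alpha>$\<beta> = 2 * c * (l$\<alpha> * l$\<beta>)" .
  have Lu: "bil \<Lambda> u u = 2 * c * a\<^sup>2"
    unfolding bil_eq outer_square_mult_vec[OF L] by (simp add: a_def inner_commute power2_eq_square)
  \<comment> \<open>The l m and l n terms of \<open>type_III_dot\<close> cancel against those of
    T(X) \<Lambda>(u,u)/2, and the T2 term completes the coefficient of l l to a multiple of
    \<open>bil sym_lkmn u u\<close>.\<close>
  have A6: "apply6 R X $\<alpha>$\<beta> = - 2 * c\<^sup>2 * a^4 * sym_lkmn$\<alpha>$\<beta>
      - 2 * c\<^sup>2 * a\<^sup>2 * (2 * a * (k \<bullet> u) + (m \<bullet> u)\<^sup>2 + (n \<bullet> u)\<^sup>2) * (l$\<alpha> * l$\<beta>)" for \<alpha> \<beta>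
    unfolding X apply6_outer[OF R] unfolding X[symmetric] A2 Lu bil_metric unfolding T X type_III_dot type_III_apply2 a_def[symmetric]
    by (simp add: algebra_simps power2_eq_square power3_eq_cube power4_eq_xxxx)
  have NNu: "bil sym_lkmn u u = 2 * a * (k \<bullet> u) + (m \<bullet> u)\<^sup>2 + (n \<bullet> u)\<^sup>2"
  proof -
    have "sym_lkmn *v u = (k \<bullet> u) *\<^sub>R l + (l \<bullet> u) *\<^sub>R k + (m \<bullet> u) *\<^sub>R m + (n \<bullet> u) *\<^sub>R n"
      by (simp add: vec_eq_iff sym_lkmn_def sym2_def matrix_vector_mult_def inner_vec_def sum_UNIV_4 algebra_simps)
    then show ?thesis unfolding bil_eq
      by (simp add: a_def inner_add_right inner_commute[of u] power2_eq_square)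
  qed
  \<comment> \<open>Both terms of R(X,X) contribute equally to this number, which is why division by
    twice T2(X,X) makes the correction in \<open>\<pi>\<close> remove exactly the l l term.\<close>
  have C6: "cubic6 R X = - 4 * c\<^sup>2 * a^4 * bil sym_lkmn u u"
  proof -
    have E: "apply6 R X *v u = (- 2 * c\<^sup>2 * a^4) *\<^sub>R (sym_lkmn *v u) + (- 2 * c\<^sup>2 * a\<^sup>2 * bil sym_lkmn u u * a) *\<^sub>R l"
      unfolding NNu by (simp add: vec_eq_iff matrix_vector_mult_def A6 a_def inner_vec_def sum_UNIV_4 algebra_simps)
    show ?thesis unfolding X cubic6_outer unfolding X[symmetric] bil_eq E
      by (simp add: inner_diff_right inner_commute[of u l] a_def[symmetric] power2_eq_square power4_eq_xxxx)
  qed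
  show "\<pi>$\<alpha>$\<beta> = - (1/2) * sym_lkmn$\<alpha>$\<beta>"
    unfolding \<pi> C6 Q using a c
    by (simp add: A6[folded NNu] A2 field_simps power2_eq_square power4_eq_xxxx)
qed

section \<open>Recovering the two self-dual forms and the phase\<close>

lemma form_lk_eq: "self_dual_form g ori (cowedge l k) $\<alpha>$\<beta> = of_real (1 / sqrt 2) * form_lk$\<alpha>$\<beta>"
  by (simp add: self_dual_form_def hodge_lk form_lk_def complex_eq_iff)

text \<open>The dual maps l \<and> m to - l \<and> n and l \<and> n to l \<and> m, so a rotation in
  the plane of m and n acts on the self-dual form as a complex phase.\<close>

lemma form_lm_eq:
  "self_dual_form g ori (cowedge (s *\<^sub>R l) (x *\<^sub>R m + y *\<^sub>R n)) $\<alpha>$\<beta> = of_real (1 / sqrt 2) * (of_real s * Complex x (- y)) * form_lm$\<alpha>$\<beta>"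
proof -
  have e: "cowedge (s *\<^sub>R l) (x *\<^sub>R m + y *\<^sub>R n) = (s * x) *\<^sub>R cowedge l m + (s * y) *\<^sub>R cowedge l n"
    by (simp add: vec_eq_iff cowedge_def algebra_simps)
  have "hodge2 g ori (cowedge (s *\<^sub>R l) (x *\<^sub>R m + y *\<^sub>R n)) = - (s * x) *\<^sub>R cowedge l n + (s * y) *\<^sub>R cowedge l m"
    unfolding e linear_add[OF linear_hodge2] linear_scale[OF linear_hodge2] hodge_lm hodge_ln by simp
  then show ?thesis unfolding e
    by (simp add: self_dual_form_def e form_lm_def complex_eq_iff)
qed

lemma lower_raise: "g *v (matrix_inv g *v x) = x"
  by (simp add: matrix_vector_mul_assoc inv)

lemma wedge_raise: "wedge g (matrix_inv g *v x) (matrix_inv g *v y) = cowedge x y"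
  by (simp add: wedge_def cowedge_def lower_raise)

text \<open>The rebuilt tensor and \<open>V\<close> are multiples of the same symmetrised product of
  \<open>form_lk\<close> and \<open>form_lm\<close>, with scalars t and z of equal modulus. Their
  quotient is the phase.\<close>

lemma type_III_weyl_reconstruction:
  assumes c: "c = 2 * (cmod z)\<^sup>2" "z \<noteq> 0" and u: "timelike g u"
    and V: "\<And>\<alpha> \<beta> \<mu> \<nu>. V$\<alpha>$\<beta>$\<mu>$\<nu> = z * (form_lk$\<alpha>$\<beta> * form_lm$\<mu>$\<nu> + form_lm$\<alpha>$\<beta> * form_lk$\<mu>$\<nu>)"
    and \<Lambda>: "\<And>\<alpha> \<beta>. \<Lambda>$\<alpha>$\<beta> = 2 * c * (l$\<alpha> * l$\<beta>)"
    and \<pi>: "\<And>\<alpha> \<beta>. \<pi>$\<alpha>$\<beta> = - (1/2) * sym_lkmn$\<alpha>$\<beta>"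
    and h: "h = (1/2) *\<^sub>R g - \<pi>" and v: "v = (1/2) *\<^sub>R g + \<pi>"
    and l': "l' = - ((1 / sqrt (bil \<Lambda> u u)) *\<^sub>R vec_apply g \<Lambda> u)"
    and e: "e = - ((1 / bil v l' u) *\<^sub>R vec_apply g v u)"
    and U: "U = wedge g l' e" and \<U>: "\<U> = self_dual_form g ori U"
  shows "0 < bil \<Lambda> u u \<and> bil v l' u \<noteq> 0 \<and> (\<exists>w. vec_apply g h w \<noteq> 0) \<and>
    (\<forall>w. vec_apply g h w \<noteq> 0 \<longrightarrow>
       0 < bil h w w \<and>
       (\<forall>p L \<L>\<^sub>0 \<W>\<^sub>0.
          p = (1 / sqrt (bil h w w)) *\<^sub>R vec_apply g h w \<longrightarrow>
          L = wedge g l' p \<longrightarrow>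
          \<L>\<^sub>0 = self_dual_form g ori L \<longrightarrow>
          \<W>\<^sub>0 = outer_form \<U> \<L>\<^sub>0 + outer_form \<L>\<^sub>0 \<U> \<longrightarrow>
          (\<exists>\<theta>::real. \<forall>\<alpha> \<beta> \<mu> \<nu>. V$\<alpha>$\<beta>$\<mu>$\<nu> = exp (\<i> * complex_of_real \<theta>) * \<W>\<^sub>0$\<alpha>$\<beta>$\<mu>$\<nu>)))"
proof -
  define a where "a = l \<bullet> u"
  have a: "a \<noteq> 0" using timelike_imp_nonzero[OF u] by (simp add: a_def)
  have c0: "c > 0" using c by simp
  have Lu: "bil \<Lambda> u u = 2 * c * a\<^sup>2"
    unfolding bil_eq outer_square_mult_vec[OF \<Lambda>] by (simp add: a_def inner_commute power2_eq_square)
  have Lu0: "0 < bil \<Lambda> u u" unfolding Lu using c0 a by simp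
  \<comment> \<open>The sign of s is opposite to that of l \<bullet> u. Only its modulus has to be
    right, as a sign is a phase.\<close>
  define s where "s = - (2 * c * a / sqrt (bil \<Lambda> u u))"
  have l's: "l' = matrix_inv g *v (s *\<^sub>R l)"
    unfolding l' vec_apply_def outer_square_mult_vec[OF \<Lambda>] matrix_vector_mult_scaleR
    by (simp add: s_def a_def)
  have "s\<^sup>2 = 2 * c"
    using Lu0 c0 a by (simp add: s_def power_divide Lu) (simp add: power2_eq_square field_simps)
  then have s2: "\<bar>s\<bar> = 2 * cmod z" "s \<noteq> 0"
  proof -
    have "s\<^sup>2 = (2 * cmod z)\<^sup>2" using \<open>s\<^sup>2 = 2 * c\<close> c by (simp add: power_mult_distrib)
    then show "\<bar>s\<bar> = 2 * cmod z" by (metis abs_of_nonneg mult_nonneg_nonneg norm_ge_zero power2_eq_iff abs_minus zero_le_numeral)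
    then show "s \<noteq> 0" using c by auto
  qed
  have vu: "v *v u = (-1) *\<^sub>R ((k \<bullet> u) *\<^sub>R l + a *\<^sub>R k)"
    by (simp add: vec_eq_iff v \<pi> sym_lkmn_def sym2_def metric matrix_vector_mult_def a_def inner_vec_def sum_UNIV_4 algebra_simps)
  have hw: "h *v w = (m \<bullet> w) *\<^sub>R m + (n \<bullet> w) *\<^sub>R n" for w
    by (simp add: vec_eq_iff h \<pi> sym_lkmn_def sym2_def metric matrix_vector_mult_def inner_vec_def sum_UNIV_4 algebra_simps)
  have vlu: "bil v l' u = s * a"
  proof -
    have "bil v l' u = (v *v u) \<bullet> l'" unfolding bil_eq by (rule inner_commute)
    then show ?thesis
      unfolding vu l's matrix_vector_mult_scaleR inner_scaleR_left inner_scaleR_right inner_add_left ip_tetrad by simp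
  qed
  have vlu0: "bil v l' u \<noteq> 0" unfolding vlu using a s2 by simp
  have e': "e = matrix_inv g *v ((1 / (s * a)) *\<^sub>R ((k \<bullet> u) *\<^sub>R l + a *\<^sub>R k))"
    unfolding e vec_apply_def vu vlu matrix_vector_mult_scaleR by simp
  \<comment> \<open>The l component of \<open>e\<close> drops out of the wedge product, and the
    factors s and 1/s cancel.\<close>
  have "U = cowedge l k"
    unfolding U l's e' wedge_raise using a s2 by (simp add: vec_eq_iff cowedge_def field_simps)
  then have UU: "\<U>$\<alpha>$\<beta> = of_real (1 / sqrt 2) * form_lk$\<alpha>$\<beta>" for \<alpha> \<beta> unfolding \<U> using form_lk_eq by simp
  \<comment> \<open>The vector obtained by raising m is fixed by \<open>h\<close>.\<close>
  have ex: "vec_apply g h (matrix_inv g *v m) \<noteq> 0"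
  proof
    assume "vec_apply g h (matrix_inv g *v m) = 0"
    then have "ip m m = 0" by (simp add: vec_apply_def hw ip_tetrad)
    then show False by (simp add: ip_tetrad)
  qed
  have main: "0 < bil h w w \<and> (\<exists>\<theta>::real. \<forall>\<alpha> \<beta> \<mu> \<nu>. V$\<alpha>$\<beta>$\<mu>$\<nu> = exp (\<i> * complex_of_real \<theta>) * \<W>\<^sub>0$\<alpha>$\<beta>$\<mu>$\<nu>)"
    if w: "vec_apply g h w \<noteq> 0" and p: "p = (1 / sqrt (bil h w w)) *\<^sub>R vec_apply g h w" and L: "L = wedge g l' p"
      and L0: "\<L>\<^sub>0 = self_dual_form g ori L" and W0: "\<W>\<^sub>0 = outer_form \<U> \<L>\<^sub>0 + outer_form \<L>\<^sub>0 \<U>" for w p L \<L>\<^sub>0 \<W>\<^sub>0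
  proof -
    define q where "q = bil h w w"
    have q: "q = (m \<bullet> w)\<^sup>2 + (n \<bullet> w)\<^sup>2"
      unfolding q_def bil_eq hw by (simp add: inner_add_right inner_commute power2_eq_square)
    have "m \<bullet> w \<noteq> 0 \<or> n \<bullet> w \<noteq> 0" using w unfolding vec_apply_def hw by auto
    then have q0: "q > 0" unfolding q by (simp add: sum_power2_gt_zero_iff)
    define x y where "x = (m \<bullet> w) / sqrt q" and "y = (n \<bullet> w) / sqrt q"
    have xy: "x\<^sup>2 + y\<^sup>2 = 1"
      using q0 by (simp add: x_def y_def power_divide add_divide_distrib[symmetric] q[symmetric])
    have "p = matrix_inv g *v (x *\<^sub>R m + y *\<^sub>R n)"
      unfolding p vec_apply_def hw q_def[symmetric]
      by (simp add: x_def y_def matrix_vector_mult_scaleR matrix_vector_right_distrib scaleR_add_right)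
    then have LL: "\<L>\<^sub>0$\<alpha>$\<beta> = of_real (1 / sqrt 2) * (of_real s * Complex x (- y)) * form_lm$\<alpha>$\<beta>" for \<alpha> \<beta>
      unfolding L0 L l's by (simp only: wedge_raise form_lm_eq)
    \<comment> \<open>The two normalisations 1/sqrt 2 multiply to 1/2, and |s| = 2|z| then gives |t|
      = |z|.\<close>
    define t where "t = of_real s * Complex x (- y) / 2"
    have half: "complex_of_real (1 / sqrt 2) * complex_of_real (1 / sqrt 2) = 1/2"
      by (simp add: of_real_mult[symmetric] del: of_real_mult)
    have WW: "\<W>\<^sub>0$\<alpha>$\<beta>$\<mu>$\<nu> = t * (form_lk$\<alpha>$\<beta> * form_lm$\<mu>$\<nu> + form_lm$\<alpha>$\<beta> * form_lk$\<mu>$\<nu>)" for \<alpha> \<beta> \<mu> \<nu>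
    proof -
      have "\<W>\<^sub>0$\<alpha>$\<beta>$\<mu>$\<nu> = (complex_of_real (1 / sqrt 2) * complex_of_real (1 / sqrt 2)) * (of_real s * Complex x (- y))
         * (form_lk$\<alpha>$\<beta> * form_lm$\<mu>$\<nu> + form_lm$\<alpha>$\<beta> * form_lk$\<mu>$\<nu>)"
        by (simp only: W0 vector_add_component outer_form_def vec_lambda_beta UU LL) (simp only: algebra_simps)
      then show ?thesis unfolding half t_def by simp
    qed
    have "cmod t = cmod z"
      using xy by (simp add: t_def norm_mult norm_divide s2 complex_norm)
    then have t: "cmod (z / t) = 1" "t \<noteq> 0" using c by (auto simp: norm_divide)
    then obtain \<theta> where \<theta>: "z / t = exp (\<i> * of_real \<theta>)" using complex_norm_eq_1_exp by metis
    have "V$\<alpha>$\<beta>$\<mu>$\<nu> = exp (\<i> * complex_of_real \<theta>) * \<W>\<^sub>0$\<alpha>$\<beta>$\<mu>$\<nu>" for \<alpha> \<beta> \<mu> \<nu>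
      unfolding V WW \<theta>[symmetric] using t by simp
    then show ?thesis using q0 q_def by blast
  qed
  show ?thesis using Lu0 vlu0 ex main by blast
qed

end

theorem theorem3:
  fixes g \<Lambda> \<pi> h v U X :: "real tensor2"
    and ori :: real
    and W T T2 :: "real tensor4"
    and R :: "real tensor6"
    and \<W> :: "complex tensor4"
    and u l e :: vect
    and \<U> :: "complex tensor2"
  assumes "lorentzian g"
    and "ori = 1 \<or> ori = -1"
    and "weyl_tensor g W"
    and "\<W> = self_dual_weyl g ori W"
    and "T = bel_robinson g ori W"
    and "T2 = tensor_comp g T T"
    and "tensor_comp g T2 T = 0"
    and "T2 \<noteq> 0"
    and "timelike g u"
    and "X = outer_vec u u"
    and "\<Lambda> = (1 / sqrt (quad4 T2 X)) *\<^sub>R apply4 T2 X"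
    and "\<forall>\<alpha> \<beta> \<mu> \<nu> \<rho> \<sigma>. 2 * R$\<alpha>$\<beta>$\<mu>$\<nu>$\<rho>$\<sigma> =
           tensor_dot g T T $\<alpha>$\<beta>$\<rho>$\<sigma>$\<mu>$\<nu> + tensor_dot g T T $\<alpha>$\<beta>$\<sigma>$\<rho>$\<mu>$\<nu>
           - T$\<alpha>$\<beta>$\<mu>$\<nu> * \<Lambda>$\<rho>$\<sigma> - 1/2 * T2$\<alpha>$\<beta>$\<mu>$\<nu> * g$\<rho>$\<sigma>"
    and "\<pi> = (1 / quad4 T2 X) *\<^sub>R
           (apply6 R X - (cubic6 R X / (2 * quad4 T2 X)) *\<^sub>R apply4 T2 X)"
    and "h = (1/2) *\<^sub>R g - \<pi>"
    and "v = (1/2) *\<^sub>R g + \<pi>"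
    and "l = - ((1 / sqrt (bil \<Lambda> u u)) *\<^sub>R vec_apply g \<Lambda> u)"
    and "e = - ((1 / bil v l u) *\<^sub>R vec_apply g v u)"
    and "U = wedge g l e"
    and "\<U> = self_dual_form g ori U"
  shows "0 < quad4 T2 X \<and> 0 < bil \<Lambda> u u \<and> bil v l u \<noteq> 0 \<and> (\<exists>w. vec_apply g h w \<noteq> 0) \<and>
    (\<forall>w. vec_apply g h w \<noteq> 0 \<longrightarrow>
       0 < bil h w w \<and>
       (\<forall>p L \<L>\<^sub>0 \<W>\<^sub>0.
          p = (1 / sqrt (bil h w w)) *\<^sub>R vec_apply g h w \<longrightarrow>
          L = wedge g l p \<longrightarrow>
          \<L>\<^sub>0 = self_dual_form g ori L \<longrightarrow>
          \<W>\<^sub>0 = outer_form \<U> \<L>\<^sub>0 + outer_form \<L>\<^sub>0 \<U> \<longrightarrow>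
          (\<exists>\<theta>::real. \<forall>\<alpha> \<beta> \<mu> \<nu>. \<W>$\<alpha>$\<beta>$\<mu>$\<nu> = exp (\<i> * complex_of_real \<theta>) * \<W>\<^sub>0$\<alpha>$\<beta>$\<mu>$\<nu>)))"
proof -
  obtain \<Theta> where cf: "coframe g ori \<Theta>"
    using coframe_exists[OF assms(1,2)] .
  obtain A where sym: "transpose A = A" and V: "\<And>\<alpha> \<beta> \<mu> \<nu>. self_dual_weyl g ori W $\<alpha>$\<beta>$\<mu>$\<nu> =
      (\<Sum>i\<in>UNIV. \<Sum>j\<in>UNIV. A$i$j * sd_form \<Theta> i $\<alpha>$\<beta> * sd_form \<Theta> j $\<mu>$\<nu>)"
    using self_dual_weyl_expansion[OF cf assms(3)] by blast
  note nil = bel_robinson_nilpotent[OF cf V assms(5-8)]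
  obtain r1 r2 r3 :: "real^3" and z \<mu> where r: "r1 \<bullet> r1 = 1" "r2 \<bullet> r2 = 1" "r1 \<bullet> r2 = 0" "r3 = cross3 r1 r2"
    and z: "z \<noteq> 0" and A: "\<And>i j. A$i$j = z * ((r3$i + \<mu> * Complex (r1$i) (r2$i)) * Complex (r1$j) (r2$j)
       + Complex (r1$i) (r2$i) * (r3$j + \<mu> * Complex (r1$j) (r2$j)))"
    using symmetric_nilpotent_rotation_form[OF sym nil] by blast
  obtain l0 k0 m0 n0 where nt: "null_tetrad g ori l0 k0 m0 n0"
    and form_lm: "\<And>\<alpha> \<beta>. (\<Sum>i\<in>UNIV. Complex (r1$i) (r2$i) * sd_form \<Theta> i $\<alpha>$\<beta>) = Complex (cowedge l0 m0 $\<alpha>$\<beta>) (cowedge l0 n0 $\<alpha>$\<beta>)"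
    and form_lk: "\<And>\<alpha> \<beta>. (\<Sum>i\<in>UNIV. (r3$i + \<mu> * Complex (r1$i) (r2$i)) * sd_form \<Theta> i $\<alpha>$\<beta>) = Complex (cowedge l0 k0 $\<alpha>$\<beta>) (cowedge m0 n0 $\<alpha>$\<beta>)"
    using null_tetrad_exists[OF cf r] by blast
  interpret null_tetrad g ori l0 k0 m0 n0 by (fact nt)
  \<comment> \<open>The matrix is a symmetrised product of two vectors, so the double sum factorises
    into the two forms. The index is \<mu>' because \<mu> already names the null rotation
    parameter.\<close>
  have V': "self_dual_weyl g ori W $\<alpha>$\<beta>$\<mu>'$\<nu> = z * (form_lk$\<alpha>$\<beta> * form_lm$\<mu>'$\<nu> + form_lm$\<alpha>$\<beta> * form_lk$\<mu>'$\<nu>)" for \<alpha> \<beta> \<mu>' \<nu>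
    unfolding V A form_lk_def form_lm_def vec_lambda_beta form_lk[symmetric] form_lm[symmetric]
    unfolding sum_product sum.distrib[symmetric] unfolding sum_distrib_left
    by (intro sum.cong refl) (simp add: algebra_simps)
  note T = assms(5)[unfolded bel_robinson_type_III[OF V']]
  have c: "2 * (cmod z)\<^sup>2 > 0" using z by simp
  note rec = type_III_reconstruction[OF c assms(9) T assms(6,10-13)]
  have "0 < quad4 T2 X"
    unfolding rec(1) using c timelike_imp_nonzero[OF assms(9)] by simp
  then show ?thesis
    using type_III_weyl_reconstruction[OF refl z assms(9) V'[folded assms(4)] rec(2,3) assms(14-19)] by blast
qed

end
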